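(* Let $N \cong \mathbb{Z}^n$ be a lattice, let $\Sigma$ be a complete fan in $N_{\mathbb{R}} = N \otimes_{\mathbb{Z}} \mathbb{R}$, let $\Sigma(1)$ be the set of primitive generators in $N$ of the 1-dimensional cones of $\Sigma$, and let $X = X(\Sigma)$ be the corresponding toric variety. If $\Sigma(1)$ is not $2$-regular, then $X$ is not diagonally split, i.e., there is no integer $q \geq 2$ such that $X$ is diagonally split at $q$.
   Context: $k$-regular: for a positive integer $k$, $\Sigma(1)$ is $k$-regular if, for every maximal linearly independent subset $\{v_1,\dots,v_n\}$ of $\Sigma(1)$, the quotient $N/\langle v_1,\dots,v_n\rangle$ is $k$-torsion, i.e., annihilated by $k$ (here $\langle v_1,\dots,v_n\rangle$ is the subgroup generated by the $v_i$). Diagonal splittings: let $X$ be a toric variety (over a field) given by a complete fan $\Sigma$. For an integer $q\ge 2$, multiplication by $q$ on $N_{\mathbb{R}}$ preserves $\Sigma$ and induces a morphism $F\colon X\to X$. A splitting of $X$ at $q$ is an $\mathcal{O}_X$-module map $\pi\colon F_*\mathcal{O}_X\to\mathcal{O}_X$ whose composition with the natural map $\mathcal{O}_X\to F_*\mathcal{O}_X$ is the identity. It is compatible with a subvariety $Z\subset X$ with ideal sheaf $I_Z$ if $\pi(F_*I_Z)\subset I_Z$. The toric variety $X$ is diagonally split at $q$ if there is a splitting at $q$ of the toric variety $X\times X$ compatible with the diagonal $\Delta\subset X\times X$. Recalled known characterization (from earlier work of Payne): with $M=\operatorname{Hom}(N,\mathbb{Z})$ and $M_{\mathbb{R}}=M\otimes_{\mathbb{Z}}\mathbb{R}$,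 $X$ is diagonally split at $q\ge 2$ if and only if the open polytope $\mathbb{F}_\Sigma=\{u\in M_{\mathbb{R}} : |\langle u,v\rangle|<1 \text{ for all } v\in\Sigma(1)\}$ contains a representative of every class in $\frac{1}{q}M/M$. *)

theory Defs
  imports
    "HOL-Analysis.Analysis"
    "HOL-Library.Poly_Mapping"
    "HOL-Computational_Algebra.Fraction_Field"
begin

section \<open>Lattices, cones and fans\<close>

definition add_subgroup :: "'v::ab_group_add set \<Rightarrow> bool" where
  "add_subgroup G \<longleftrightarrow> 0 \<in> G \<and> (\<forall>x\<in>G. \<forall>y\<in>G. x - y \<in> G)"

text \<open>A lattice \<open>N\<close> of rank \<open>n\<close> is the subgroup generated by \<open>n\<close> linearly independent vectors
  of a Euclidean space. The space \<open>N\<^sub>\<real>\<close> is then \<open>span N\<close>, which may be a proper subspace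
  of the ambient space (so that rank zero is included).\<close>

definition is_lattice :: "'v::euclidean_space set \<Rightarrow> bool" where
  "is_lattice N \<longleftrightarrow> (\<exists>B. independent B \<and> N = add_subgroup hull B)"

text \<open>\<open>M = Hom(N, \<int>)\<close>, with a homomorphism represented by the unique vector of \<open>span N\<close> inducing
  it through the inner product.\<close>

definition dual_lattice :: "'v::euclidean_space set \<Rightarrow> 'v set" where
  "dual_lattice N = {u \<in> span N. \<forall>v\<in>N. u \<bullet> v \<in> \<int>}"

definition rational_cone :: "'v::euclidean_space set \<Rightarrow> 'v set \<Rightarrow> bool" where
  "rational_cone N \<sigma> \<longleftrightarrow> (\<exists>S. finite S \<and> S \<subseteq> N \<and> \<sigma> = convex_cone hull S)"

definition strongly_convex :: "'v::euclidean_space set \<Rightarrow> bool" where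
  "strongly_convex \<sigma> \<longleftrightarrow> \<sigma> \<inter> uminus ` \<sigma> = {0}"

text \<open>The relation \<open>face_of\<close> admits the empty set as a face, which is not a face of a cone in the
  sense of toric geometry. The nonempty faces of a polyhedral cone \<open>\<sigma>\<close> are the sets
  \<open>\<sigma> \<inter> u\<^sup>\<bottom>\<close> for \<open>u\<close> in the dual cone.\<close>

definition fan :: "'v::euclidean_space set \<Rightarrow> 'v set set \<Rightarrow> bool" where
  "fan N \<Sigma> \<longleftrightarrow>
     finite \<Sigma> \<and>
     (\<forall>\<sigma>\<in>\<Sigma>. rational_cone N \<sigma> \<and> strongly_convex \<sigma>) \<and>
     (\<forall>\<sigma>\<in>\<Sigma>. \<forall>\<tau>. \<tau> face_of \<sigma> \<and> \<tau> \<noteq> {} \<longrightarrow> \<tau> \<in> \<Sigma>) \<and>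
     (\<forall>\<sigma>\<in>\<Sigma>. \<forall>\<tau>\<in>\<Sigma>. (\<sigma> \<inter> \<tau>) face_of \<sigma> \<and> (\<sigma> \<inter> \<tau>) face_of \<tau>)"

definition complete_fan :: "'v::euclidean_space set \<Rightarrow> 'v set set \<Rightarrow> bool" where
  "complete_fan N \<Sigma> \<longleftrightarrow> fan N \<Sigma> \<and> \<Union>\<Sigma> = span N"

definition primitive :: "'v::euclidean_space set \<Rightarrow> 'v \<Rightarrow> bool" where
  "primitive N v \<longleftrightarrow>
     v \<in> N \<and> v \<noteq> 0 \<and> (\<forall>w\<in>N. \<forall>m::int. v = of_int m *\<^sub>R w \<longrightarrow> \<bar>m\<bar> = 1)"

definition ray_generators :: "'v::euclidean_space set \<Rightarrow> 'v set set \<Rightarrow> 'v set" where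
  "ray_generators N \<Sigma> = {v. primitive N v \<and> convex_cone hull {v} \<in> \<Sigma>}"

text \<open>For subsets of a lattice, linear independence over \<open>\<int>\<close> and over \<open>\<real>\<close> agree.\<close>

definition k_regular :: "nat \<Rightarrow> 'v::euclidean_space set \<Rightarrow> 'v set \<Rightarrow> bool" where
  "k_regular k N R \<longleftrightarrow>
     (\<forall>B. B \<subseteq> R \<and> independent B \<and> (\<forall>C. B \<subseteq> C \<and> C \<subseteq> R \<and> independent C \<longrightarrow> C = B) \<longrightarrow>
        (\<forall>w\<in>N. of_nat k *\<^sub>R w \<in> add_subgroup hull B))"

definition product_fan :: "'v set set \<Rightarrow> 'w set set \<Rightarrow> ('v \<times> 'w) set set" where
  "product_fan \<Sigma> \<Sigma>' = {\<sigma> \<times> \<tau> | \<sigma> \<tau>. \<sigma> \<in> \<Sigma> \<and> \<tau> \<in> \<Sigma>'}"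


section \<open>The group algebra of a vector space\<close>

text \<open>\<open>('v, 'k) group_alg\<close> is the group algebra \<open>k['v]\<close>. It contains \<open>k[M]\<close> for every lattice
  \<open>M\<close> in \<open>'v\<close>. It is a copy of the type of finitely supported functions \<open>'v \<Rightarrow>\<^sub>0 'k\<close>, whose existing
  instance as an integral domain needs a linear order on the exponents.\<close>

typedef (overloaded) ('v, 'k) group_alg = "UNIV :: ('v \<Rightarrow>\<^sub>0 'k::zero) set"
  morphisms to_pm of_pm ..

setup_lifting type_definition_group_alg

instantiation group_alg :: (comm_monoid_add, comm_ring_1) comm_ring_1
begin

lift_definition zero_group_alg :: "('a, 'b) group_alg" is 0 .
lift_definition one_group_alg :: "('a, 'b) group_alg" is 1 .
lift_definition plus_group_alg :: "('a, 'b) group_alg \<Rightarrow> ('a, 'b) group_alg \<Rightarrow> ('a, 'b) group_alg"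
  is "(+)" .
lift_definition minus_group_alg :: "('a, 'b) group_alg \<Rightarrow> ('a, 'b) group_alg \<Rightarrow> ('a, 'b) group_alg"
  is "(-)" .
lift_definition uminus_group_alg :: "('a, 'b) group_alg \<Rightarrow> ('a, 'b) group_alg" is uminus .
lift_definition times_group_alg :: "('a, 'b) group_alg \<Rightarrow> ('a, 'b) group_alg \<Rightarrow> ('a, 'b) group_alg"
  is "(*)" .

instance
  by (intro_classes; transfer; simp add: algebra_simps)

end

lemma lookup_times_keys:
  fixes f g :: "'a::comm_monoid_add \<Rightarrow>\<^sub>0 'b::comm_ring_1"
  shows "Poly_Mapping.lookup (f * g) c =
    (\<Sum>a\<in>Poly_Mapping.keys f. \<Sum>b\<in>Poly_Mapping.keys g.
       if c = a + b then Poly_Mapping.lookup f a * Poly_Mapping.lookup g b else 0)"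
proof -
  have "(\<Sum>q. Poly_Mapping.lookup g q when c = a + q) =
      (\<Sum>b\<in>Poly_Mapping.keys g. if c = a + b then Poly_Mapping.lookup g b else 0)" for a
  proof -
    have "(\<Sum>q. Poly_Mapping.lookup g q when c = a + q) =
        (\<Sum>b\<in>Poly_Mapping.keys g. Poly_Mapping.lookup g b when c = a + b)"
      by (rule Sum_any.expand_superset) (auto simp: in_keys_iff)
    then show ?thesis by (simp add: when_def)
  qed
  then have "Poly_Mapping.lookup (f * g) c = (\<Sum>a. Poly_Mapping.lookup f a *
      (\<Sum>b\<in>Poly_Mapping.keys g. if c = a + b then Poly_Mapping.lookup g b else 0))"
    by (simp add: lookup_mult)
  also have "\<dots> = (\<Sum>a\<in>Poly_Mapping.keys f. Poly_Mapping.lookup f a *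
      (\<Sum>b\<in>Poly_Mapping.keys g. if c = a + b then Poly_Mapping.lookup g b else 0))"
    by (rule Sum_any.expand_superset) (auto simp: in_keys_iff)
  also have "\<dots> = (\<Sum>a\<in>Poly_Mapping.keys f. \<Sum>b\<in>Poly_Mapping.keys g.
       if c = a + b then Poly_Mapping.lookup f a * Poly_Mapping.lookup g b else 0)"
    by (simp add: sum_distrib_left if_distrib cong: if_cong)
  finally show ?thesis .
qed

text \<open>The proof looks at a sum \<open>a + b\<close> of exponents of maximal norm; by strict convexity it arises
  from only one pair of exponents.\<close>

lemma group_ring_no_zero_divisors:
  fixes f g :: "'v::real_inner \<Rightarrow>\<^sub>0 'k::idom"
  assumes "f \<noteq> 0" "g \<noteq> 0"
  shows "f * g \<noteq> 0"
proof -
  let ?F = "Poly_Mapping.keys f" and ?G = "Poly_Mapping.keys g"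
  let ?N = "(\<lambda>(a, b). norm (a + b)) ` (?F \<times> ?G)"
  have ne: "?F \<noteq> {}" "?G \<noteq> {}" using assms by auto
  then have "Max ?N \<in> ?N" by (intro Max_in) auto
  then obtain a b where ab: "a \<in> ?F" "b \<in> ?G" and mx: "Max ?N = norm (a + b)" by auto
  have le: "norm (x + y) \<le> norm (a + b)" if "x \<in> ?F" "y \<in> ?G" for x y
    unfolding mx [symmetric] using that by (intro Max_ge) auto
  have uniq: "x = a \<and> y = b" if xy: "x \<in> ?F" "y \<in> ?G" "a + b = x + y" for x y
  proof -
    let ?s = "a + y" and ?t = "x + b" and ?c = "a + b"
    have st: "?s + ?t = 2 *\<^sub>R ?c" using xy(3) by (simp add: scaleR_2 algebra_simps)
    have "(norm (?s - ?t))\<^sup>2 + (norm (?s + ?t))\<^sup>2 = 2 * (norm ?s)\<^sup>2 + 2 * (norm ?t)\<^sup>2"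
      unfolding power2_norm_eq_inner by (simp add: inner_simps inner_commute)
    moreover have "(norm ?s)\<^sup>2 \<le> (norm ?c)\<^sup>2" "(norm ?t)\<^sup>2 \<le> (norm ?c)\<^sup>2"
      using le[OF ab(1) xy(2)] le[OF xy(1) ab(2)] by (simp_all add: power_mono)
    moreover have "(norm (?s + ?t))\<^sup>2 = 4 * (norm ?c)\<^sup>2"
      unfolding st by (simp add: power_mult_distrib)
    ultimately have "(norm (?s - ?t))\<^sup>2 \<le> 0" by linarith
    then have "?s = ?t" by simp
    with st have "2 *\<^sub>R ?s = 2 *\<^sub>R ?c" by (simp add: scaleR_2)
    then have "?s = ?c" by simp
    then show ?thesis using xy(3) by auto
  qed
  have "Poly_Mapping.lookup (f * g) (a + b) = (\<Sum>x\<in>?F. \<Sum>y\<in>?G.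
      if x = a \<and> y = b then Poly_Mapping.lookup f a * Poly_Mapping.lookup g b else 0)"
    unfolding lookup_times_keys using uniq by (intro sum.cong refl) auto
  also have "\<dots> = (\<Sum>x\<in>?F. if x = a then Poly_Mapping.lookup f a * Poly_Mapping.lookup g b else 0)"
    using ab by (intro sum.cong refl) (auto simp: sum.delta)
  also have "\<dots> = Poly_Mapping.lookup f a * Poly_Mapping.lookup g b"
    using ab by (simp add: sum.delta)
  also have "\<dots> \<noteq> 0" using ab by (simp add: in_keys_iff)
  finally show ?thesis by auto
qed

instance group_alg :: (real_inner, idom) idom
  by (intro_classes; transfer; rule group_ring_no_zero_divisors)

lift_definition exponents :: "('v, 'k::zero) group_alg \<Rightarrow> 'v set" is Poly_Mapping.keys .

text \<open>The algebra homomorphism induced by a homomorphism \<open>h\<close> of exponents, \<open>x\<^sup>u \<mapsto> x\<^sup>h\<^sup>(\<^sup>u\<^sup>)\<close>.\<close>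

lift_definition alg_map :: "('v \<Rightarrow> 'w) \<Rightarrow> ('v, 'k) group_alg \<Rightarrow> ('w, 'k::comm_monoid_add) group_alg"
  is "\<lambda>h f. \<Sum>u\<in>Poly_Mapping.keys f. Poly_Mapping.single (h u) (Poly_Mapping.lookup f u)" .


section \<open>Integral schemes from charts\<close>

text \<open>Let \<open>\<A>\<close> be a collection of subrings of a domain \<open>'a\<close>, all with the same fraction field
  \<open>K\<close>, a subfield of \<open>'a fract\<close>, such that the affine schemes \<open>Spec A\<close> for \<open>A \<in> \<A>\<close> are the charts of an integral separated scheme. A
  point of this scheme is determined by its local ring, a subring of \<open>K\<close>, and points of two charts
  are identified exactly if they have the same local ring. So a point is represented here by its
  local ring \<open>A\<^sub>p\<close>, and the scheme by its set of points.\<close>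

definition prime_ideal :: "'a::idom set \<Rightarrow> 'a set \<Rightarrow> bool" where
  "prime_ideal A p \<longleftrightarrow>
     p \<subseteq> A \<and> 0 \<in> p \<and> (\<forall>a\<in>p. \<forall>b\<in>p. a + b \<in> p) \<and> (\<forall>a\<in>A. \<forall>b\<in>p. a * b \<in> p) \<and>
     1 \<notin> p \<and> (\<forall>a\<in>A. \<forall>b\<in>A. a * b \<in> p \<longrightarrow> a \<in> p \<or> b \<in> p)"

definition localization :: "'a::idom set \<Rightarrow> 'a set \<Rightarrow> 'a fract set" where
  "localization A p = {Fract a s | a s. a \<in> A \<and> s \<in> A \<and> s \<notin> p}"

definition basic_open :: "'a::idom set \<Rightarrow> 'a \<Rightarrow> 'a fract set set" where
  "basic_open A f = {localization A p | p. prime_ideal A p \<and> f \<notin> p}"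

definition zariski_open :: "'a::idom set set \<Rightarrow> 'a fract set set \<Rightarrow> bool" where
  "zariski_open \<A> U \<longleftrightarrow> (\<exists>\<B>. \<B> \<subseteq> {basic_open A f | A f. A \<in> \<A> \<and> f \<in> A} \<and> U = \<Union>\<B>)"

text \<open>On an integral scheme \<open>\<O>(U)\<close> is the intersection in \<open>K\<close> of the local rings at the points of
  \<open>U\<close>, for \<open>U \<noteq> {}\<close>, and the restriction maps between nonempty open sets are the inclusions. Since
  \<open>\<O>({}) = 0\<close>, sheaves and their maps only have to be considered on nonempty open sets.\<close>

definition sections :: "'a::idom fract set set \<Rightarrow> 'a fract set" where
  "sections U = \<Inter>U"

definition maximal_ideal :: "'a::idom fract set \<Rightarrow> 'a fract set" where
  "maximal_ideal x = {s \<in> x. s = 0 \<or> inverse s \<notin> x}"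

text \<open>Sections over \<open>U\<close> of the ideal sheaf of a closed set \<open>Z\<close> with its reduced structure: they lie in
  the maximal ideal at each point of \<open>Z\<close>. The alternative \<open>s = 0\<close> is needed as \<open>inverse 0 = 0\<close>.\<close>

definition ideal_sections :: "'a::idom fract set set \<Rightarrow> 'a fract set set \<Rightarrow> 'a fract set" where
  "ideal_sections Z U = {s \<in> sections U. \<forall>x\<in>Z \<inter> U. s \<in> maximal_ideal x}"

text \<open>Let \<open>\<phi>\<close> be an endomorphism of the ambient domain that maps every chart \<open>A \<in> \<A>\<close> to itself,
  such that the morphisms \<open>Spec A \<rightarrow> Spec A\<close> glue to a morphism \<open>F\<close> of the scheme. The preimage of
  \<open>U\<close> under \<open>F\<close> is as follows. If \<open>\<phi>\<close> is injective, the maps \<open>\<O>(U) \<rightarrow> \<O>(F\<^sup>-\<^sup>1 U)\<close> are restrictions of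
  the induced map of fraction fields.\<close>

definition preimage :: "'a::idom set set \<Rightarrow> ('a \<Rightarrow> 'a) \<Rightarrow> 'a fract set set \<Rightarrow> 'a fract set set" where
  "preimage \<A> \<phi> U = {localization A p | A p.
     A \<in> \<A> \<and> prime_ideal A p \<and> localization A {a \<in> A. \<phi> a \<in> p} \<in> U}"

definition fract_map :: "('a::idom \<Rightarrow> 'a) \<Rightarrow> 'a fract \<Rightarrow> 'a fract" where
  "fract_map \<phi> z = (THE w. \<exists>a b. b \<noteq> 0 \<and> z = Fract a b \<and> w = Fract (\<phi> a) (\<phi> b))"


section \<open>Toric varieties and diagonal splittings\<close>

text \<open>The ring \<open>k[\<sigma>\<^sup>\<or> \<inter> M]\<close>.\<close>

definition cone_ring :: "'v::euclidean_space set \<Rightarrow> 'v set \<Rightarrow> ('v, 'k::field) group_alg set" where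
  "cone_ring N \<sigma> = {f. exponents f \<subseteq> {u \<in> dual_lattice N. \<forall>v\<in>\<sigma>. 0 \<le> u \<bullet> v}}"

text \<open>\<open>toric_charts N \<Sigma> :: ('v, 'k) group_alg set set\<close> describes the toric variety \<open>X(\<Sigma>)\<close> over the
  field \<open>'k\<close>.\<close>

definition toric_charts :: "'v::euclidean_space set \<Rightarrow> 'v set set \<Rightarrow> ('v, 'k::field) group_alg set set"
  where "toric_charts N \<Sigma> = cone_ring N ` \<Sigma>"

text \<open>Multiplication by \<open>q\<close> on \<open>N\<close> induces the map \<open>x\<^sup>u \<mapsto> x\<^sup>q\<^sup>u\<close> on every chart.\<close>

abbreviation mult_alg :: "nat \<Rightarrow> ('v::euclidean_space, 'k::field) group_alg \<Rightarrow> ('v, 'k) group_alg"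
  where "mult_alg q \<equiv> alg_map (\<lambda>u. of_nat q *\<^sub>R u)"

abbreviation mult_preimage ::
    "'v::euclidean_space set \<Rightarrow> 'v set set \<Rightarrow> nat \<Rightarrow>
     ('v, 'k::field) group_alg fract set set \<Rightarrow> ('v, 'k) group_alg fract set set"
  where "mult_preimage N \<Sigma> q \<equiv> preimage (toric_charts N \<Sigma>) (mult_alg q)"

text \<open>The family \<open>\<pi> U : \<O>(F\<^sup>-\<^sup>1 U) \<rightarrow> \<O>(U)\<close> is a map of \<open>\<O>\<close>-modules \<open>F\<^sub>* \<O> \<rightarrow> \<O>\<close>.\<close>

definition module_map ::
    "'v::euclidean_space set \<Rightarrow> 'v set set \<Rightarrow> nat \<Rightarrow>
     (('v, 'k::field) group_alg fract set set \<Rightarrow> ('v, 'k) group_alg fract \<Rightarrow> ('v, 'k) group_alg fract)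
     \<Rightarrow> bool" where
  "module_map N \<Sigma> q \<pi> \<longleftrightarrow>
     (\<forall>U. zariski_open (toric_charts N \<Sigma>) U \<and> U \<noteq> {} \<longrightarrow>
        (\<forall>t \<in> sections (mult_preimage N \<Sigma> q U). \<pi> U t \<in> sections U) \<and>
        (\<forall>t \<in> sections (mult_preimage N \<Sigma> q U). \<forall>t' \<in> sections (mult_preimage N \<Sigma> q U).
           \<pi> U (t + t') = \<pi> U t + \<pi> U t') \<and>
        (\<forall>s \<in> sections U. \<forall>t \<in> sections (mult_preimage N \<Sigma> q U).
           \<pi> U (fract_map (mult_alg q) s * t) = s * \<pi> U t) \<and>
        (\<forall>V. zariski_open (toric_charts N \<Sigma>) V \<and> V \<noteq> {} \<and> V \<subseteq> U \<longrightarrow>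
           (\<forall>t \<in> sections (mult_preimage N \<Sigma> q U). \<pi> V t = \<pi> U t)))"

definition splitting ::
    "'v::euclidean_space set \<Rightarrow> 'v set set \<Rightarrow> nat \<Rightarrow>
     (('v, 'k::field) group_alg fract set set \<Rightarrow> ('v, 'k) group_alg fract \<Rightarrow> ('v, 'k) group_alg fract)
     \<Rightarrow> bool" where
  "splitting N \<Sigma> q \<pi> \<longleftrightarrow>
     module_map N \<Sigma> q \<pi> \<and>
     (\<forall>U. zariski_open (toric_charts N \<Sigma>) U \<and> U \<noteq> {} \<longrightarrow>
        (\<forall>s \<in> sections U. \<pi> U (fract_map (mult_alg q) s) = s))"

definition compatible ::
    "'v::euclidean_space set \<Rightarrow> 'v set set \<Rightarrow> nat \<Rightarrow>
     (('v, 'k::field) group_alg fract set set \<Rightarrow> ('v, 'k) group_alg fract \<Rightarrow> ('v, 'k) group_alg fract) \<Rightarrow>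
     ('v, 'k) group_alg fract set set \<Rightarrow> bool" where
  "compatible N \<Sigma> q \<pi> Z \<longleftrightarrow>
     (\<forall>U. zariski_open (toric_charts N \<Sigma>) U \<and> U \<noteq> {} \<longrightarrow>
        (\<forall>t \<in> ideal_sections Z (mult_preimage N \<Sigma> q U). \<pi> U t \<in> ideal_sections Z U))"

text \<open>The product \<open>X(\<Sigma>) \<times> X(\<Sigma>)\<close> is the toric variety of the fan \<open>\<Sigma> \<times> \<Sigma>\<close> for the lattice \<open>N \<times> N\<close>. On
  the charts given by \<open>\<sigma>\<close> and \<open>\<sigma> \<times> \<sigma>\<close>, the diagonal morphism \<open>X \<rightarrow> X \<times> X\<close> is induced by
  \<open>x\<^sup>(\<^sup>u\<^sup>,\<^sup>w\<^sup>) \<mapsto> x\<^sup>u\<^sup>+\<^sup>w\<close>, and its image is covered by these charts.\<close>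

definition diagonal ::
    "'v::euclidean_space set \<Rightarrow> 'v set set \<Rightarrow> ('v \<times> 'v, 'k::field) group_alg fract set set" where
  "diagonal N \<Sigma> =
     {localization (cone_ring (N \<times> N) (\<sigma> \<times> \<sigma>))
        {f \<in> cone_ring (N \<times> N) (\<sigma> \<times> \<sigma>). alg_map (\<lambda>(u, w). u + w) f \<in> p} | \<sigma> p.
      \<sigma> \<in> \<Sigma> \<and> prime_ideal (cone_ring N \<sigma>) p}"

definition diagonally_split ::
    "'k::field itself \<Rightarrow> 'v::euclidean_space set \<Rightarrow> 'v set set \<Rightarrow> nat \<Rightarrow> bool" where
  "diagonally_split _ N \<Sigma> q \<longleftrightarrow>
     (\<exists>\<pi> :: ('v \<times> 'v, 'k) group_alg fract set set
          \<Rightarrow> ('v \<times> 'v, 'k) group_alg fract \<Rightarrow> ('v \<times> 'v, 'k) group_alg fract.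
        splitting (N \<times> N) (product_fan \<Sigma> \<Sigma>) q \<pi> \<and>
        compatible (N \<times> N) (product_fan \<Sigma> \<Sigma>) q \<pi> (diagonal N \<Sigma>))"

end

theory Submission
  imports Defs
begin

text \<open>
  A splitting \<open>\<pi>\<close> of \<open>X \<times> X\<close> at \<open>q\<close> sends the character \<open>x\<^sup>(\<^sup>m\<^sup>,\<^sup>-\<^sup>m\<^sup>)\<close>, which is \<open>1\<close> on the diagonal of the
  torus, to a Laurent polynomial \<open>g\<close>. Compatibility with the diagonal makes \<open>g\<close> restrict to \<open>1\<close> there, so
  \<open>g\<close> has an exponent of the form \<open>(b, -b)\<close>. Regularity of \<open>\<pi>\<close> along the boundary divisors of \<open>v\<close> in both
  factors gives \<open>\<bar>\<langle>m/q - b, v\<rangle>\<bar> < 1\<close> for all \<open>v \<in> \<Sigma>(1)\<close>. This is one direction of Payne's criterion.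

  Let \<open>e\<close> be the member dual to \<open>v\<close> of the dual basis of a basis contained in \<open>\<Sigma>(1)\<close>, and let \<open>d\<close> be the
  least positive integer with \<open>d e \<in> M\<close>. If \<open>d \<ge> 3\<close>, some \<open>j\<close> satisfies \<open>1 \<le> j d / q \<le> d - 1\<close>, and the \<open>b\<close>
  obtained for \<open>m = j d e\<close> must be \<open>c e\<close> with \<open>0 < c < d\<close>, contradicting the choice of \<open>d\<close>. So \<open>2 e \<in> M\<close>
  for all \<open>e\<close>, which is dual to \<open>2\<close>-regularity.
\<close>

section \<open>Lattices and their duals\<close>

lemma add_subgroup_Inter: "(\<And>G. G \<in> \<G> \<Longrightarrow> add_subgroup G) \<Longrightarrow> add_subgroup (\<Inter>\<G>)"
  by (auto simp: add_subgroup_def)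

lemma add_subgroup_hull: "add_subgroup (add_subgroup hull S)"
  by (rule hull_in, rule add_subgroup_Inter) blast

context
  fixes G :: "'v::ab_group_add set"
  assumes G: "add_subgroup G"
begin

lemma add_subgroup_0: "0 \<in> G"
  using G by (simp add: add_subgroup_def)

lemma add_subgroup_diff: "x \<in> G \<Longrightarrow> y \<in> G \<Longrightarrow> x - y \<in> G"
  using G by (simp add: add_subgroup_def)

lemma add_subgroup_uminus: "x \<in> G \<Longrightarrow> - x \<in> G"
  using add_subgroup_diff[OF add_subgroup_0] by simp

lemma add_subgroup_add: "x \<in> G \<Longrightarrow> y \<in> G \<Longrightarrow> x + y \<in> G"
  using add_subgroup_diff[of x "- y"] add_subgroup_uminus by simp

lemma add_subgroup_sum: "(\<And>i. i \<in> I \<Longrightarrow> f i \<in> G) \<Longrightarrow> sum f I \<in> G"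
  by (induction I rule: infinite_finite_induct) (auto intro: add_subgroup_0 add_subgroup_add)

end

lemma add_subgroup_scale_nat:
  fixes G :: "'v::real_vector set"
  assumes "add_subgroup G" "x \<in> G" shows "of_nat n *\<^sub>R x \<in> G"
  by (induction n) (simp_all add: assms add_subgroup_0 add_subgroup_add scaleR_add_left)

lemma add_subgroup_scale_int:
  fixes G :: "'v::real_vector set"
  assumes "add_subgroup G" "x \<in> G" shows "of_int m *\<^sub>R x \<in> G"
proof (cases m rule: int_cases2)
  case (nonneg n)
  then show ?thesis using add_subgroup_scale_nat[OF assms] by simp
next
  case (nonpos n)
  then show ?thesis using add_subgroup_uminus[OF assms(1) add_subgroup_scale_nat[OF assms, of n]]
    by simp
qed

lemma add_subgroup_scale_Ints:
  fixes G :: "'v::real_vector set"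
  assumes "add_subgroup G" "x \<in> G" "c \<in> \<int>" shows "c *\<^sub>R x \<in> G"
  using assms add_subgroup_scale_int by (metis Ints_cases)

section \<open>Dual bases with respect to the inner product\<close>

lemma exists_inner_eq:
  fixes B :: "'v::euclidean_space set"
  assumes "independent B"
  obtains u where "u \<in> span B" "\<And>b. b \<in> B \<Longrightarrow> u \<bullet> b = f b"
proof -
  obtain g where g: "linear g" "\<And>b. b \<in> B \<Longrightarrow> g b = f b"
    using linear_independent_extend[OF assms, of f] by blast
  \<comment> \<open>By Riesz, \<open>adjoint g 1\<close> represents the functional \<open>g\<close>.
    Its component in \<open>span B\<close> takes the same values on \<open>B\<close>, the discarded
    part being orthogonal to \<open>span B\<close>.\<close>
  obtain y z where yz: "y \<in> span B" "\<And>w. w \<in> span B \<Longrightarrow> orthogonal z w" "adjoint g 1 = y + z"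
    using orthogonal_subspace_decomp_exists[of B "adjoint g 1"] by metis
  have "y \<bullet> b = f b" if b: "b \<in> B" for b
  proof -
    have "(y + z) \<bullet> b = g b"
      using adjoint_works[OF g(1), of b 1] by (simp add: yz(3) inner_commute)
    moreover have "z \<bullet> b = 0"
      using yz(2)[of b] b by (simp add: orthogonal_def span_base)
    ultimately show ?thesis using g(2)[OF b] by (simp add: inner_add_left)
  qed
  with yz(1) that show thesis by blast
qed

text \<open>\<open>x - y\<close> is orthogonal to \<open>span B\<close> and lies in it, so it is
  orthogonal to itself.\<close>

lemma span_eqI_inner:
  fixes x y :: "'v::euclidean_space"
  assumes "x \<in> span B" "y \<in> span B" "\<And>b. b \<in> B \<Longrightarrow> x \<bullet> b = y \<bullet> b"
  shows "x = y"
proof -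
  have "(x - y) \<bullet> w = 0" if "w \<in> span B" for w
    using that
  proof (induction rule: span_induct_alt)
    case (step c b w)
    then show ?case using assms(3)[of b] by (simp add: inner_simps)
  qed simp
  from this[of "x - y"] show ?thesis using assms by (simp add: span_diff)
qed

text \<open>The dual basis of \<open>B\<close>, with functionals on \<open>span B\<close> realized
  as vectors through the inner product. For independent \<open>B\<close> the conditions have exactly
  one solution, so the choice operator selects nothing arbitrary.\<close>

definition dual_vec :: "'v::euclidean_space set \<Rightarrow> 'v \<Rightarrow> 'v" where
  "dual_vec B b = (SOME u. u \<in> span B \<and> (\<forall>b'\<in>B. u \<bullet> b' = (if b' = b then 1 else 0)))"

lemma dual_vec:
  assumes "independent B"
  shows dual_vec_span: "dual_vec B b \<in> span B"
    and inner_dual_vec: "b' \<in> B \<Longrightarrow> dual_vec B b \<bullet> b' = (if b' = b then 1 else 0)"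
proof -
  have "\<exists>u. u \<in> span B \<and> (\<forall>b'\<in>B. u \<bullet> b' = (if b' = b then 1 else 0))"
    using exists_inner_eq[OF assms, of "\<lambda>b'. if b' = b then 1 else 0"] by metis
  from someI_ex[OF this] show "dual_vec B b \<in> span B"
    and "b' \<in> B \<Longrightarrow> dual_vec B b \<bullet> b' = (if b' = b then 1 else 0)"
    by (simp_all add: dual_vec_def)
qed

lemma dual_vec_expansion:
  fixes B :: "'v::euclidean_space set"
  assumes "independent B" "w \<in> span B"
  shows "w = (\<Sum>b\<in>B. (dual_vec B b \<bullet> w) *\<^sub>R b)"
  using assms(2)
proof (induction rule: span_induct_alt)
  case base
  show ?case by simp
next
  case (step c b w)
  have fin: "finite B" using assms(1) by (rule independent_imp_finite)
  have "(\<Sum>b'\<in>B. (dual_vec B b' \<bullet> (c *\<^sub>R b)) *\<^sub>R b') = (\<Sum>b'\<in>B. if b = b' then c *\<^sub>R b' else 0)"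
    using step by (intro sum.cong) (auto simp: inner_dual_vec[OF assms(1)])
  also have "\<dots> = c *\<^sub>R b" using fin step by simp
  finally show ?case using step(2)
    by (simp add: inner_add_right scaleR_add_left sum.distrib)
qed

section \<open>The dual lattice, biduality and primitive vectors\<close>

lemma dual_lattice_add_subgroup: "add_subgroup (dual_lattice N)"
  by (auto simp: add_subgroup_def dual_lattice_def inner_diff_left span_zero span_diff)

text \<open>Integrality of the pairing holds on a subgroup, so it suffices to test it on the
  generators \<open>B\<close>.\<close>

lemma dual_vec_in_dual_lattice:
  assumes "independent B" "N = add_subgroup hull B"
  shows "dual_vec B b \<in> dual_lattice N"
proof -
  have "add_subgroup {v. dual_vec B b \<bullet> v \<in> \<int>}"
    by (auto simp: add_subgroup_def inner_diff_right)
  moreover have "B \<subseteq> {v. dual_vec B b \<bullet> v \<in> \<int>}"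
    by (auto simp: inner_dual_vec[OF assms(1)])
  ultimately have "N \<subseteq> {v. dual_vec B b \<bullet> v \<in> \<int>}"
    unfolding assms(2) by (rule hull_minimal[rotated])
  moreover have "dual_vec B b \<in> span N"
    using dual_vec_span[OF assms(1)] span_mono[of B N] assms(2) by (metis hull_subset subsetD)
  ultimately show ?thesis by (auto simp: dual_lattice_def)
qed

lemma add_subgroup_hull_subset_span: "add_subgroup hull B \<subseteq> span B"
  by (rule hull_minimal) (auto simp: add_subgroup_def span_zero span_diff span_base)

lemma span_add_subgroup_hull: "span (add_subgroup hull B) = span B"
  by (meson add_subgroup_hull_subset_span hull_subset span_eq span_superset subset_trans)

lemma add_subgroup_hull_integral_coords:
  assumes "independent B" "w \<in> span B" "\<And>b. b \<in> B \<Longrightarrow> dual_vec B b \<bullet> w \<in> \<int>"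
  shows "w \<in> add_subgroup hull B"
proof -
  have "(\<Sum>b\<in>B. (dual_vec B b \<bullet> w) *\<^sub>R b) \<in> add_subgroup hull B"
    by (intro add_subgroup_sum add_subgroup_hull add_subgroup_scale_Ints assms hull_inc)
  then show ?thesis using dual_vec_expansion[OF assms(1,2)] by simp
qed

lemma lattice_add_subgroup: "is_lattice N \<Longrightarrow> add_subgroup N"
  by (auto simp: is_lattice_def add_subgroup_hull)

text \<open>Biduality: the dual basis of a lattice basis lies in \<open>dual_lattice N\<close>, so
  the hypothesis makes every coordinate of \<open>w\<close> integral.\<close>

lemma in_lattice_if_dual_integral:
  assumes "is_lattice N" "w \<in> span N" "\<And>u. u \<in> dual_lattice N \<Longrightarrow> u \<bullet> w \<in> \<int>"
  shows "w \<in> N"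
proof -
  obtain B where B: "independent B" "N = add_subgroup hull B"
    using assms(1) by (auto simp: is_lattice_def)
  show ?thesis
    unfolding B(2)
    using assms(2,3) B dual_vec_in_dual_lattice[OF B]
    by (intro add_subgroup_hull_integral_coords) (auto simp: span_add_subgroup_hull)
qed

lemma lattice_eq_0_if_dual_0:
  assumes "is_lattice N" "w \<in> span N" "\<And>u. u \<in> dual_lattice N \<Longrightarrow> u \<bullet> w = 0"
  shows "w = 0"
proof -
  obtain B where B: "independent B" "N = add_subgroup hull B"
    using assms(1) by (auto simp: is_lattice_def)
  then have "w \<in> span B" using assms(2) by (simp add: span_add_subgroup_hull)
  from dual_vec_expansion[OF B(1) this] show ?thesis
    using assms(3)[OF dual_vec_in_dual_lattice[OF B]] by simp
qed

text \<open>Coordinates in a lattice basis embed the ball into a finite box of integer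
  points.\<close>

lemma finite_lattice_bounded:
  assumes "is_lattice N"
  shows "finite {w \<in> N. norm w \<le> r}"
proof -
  obtain B where B: "independent B" "N = add_subgroup hull B"
    using assms by (auto simp: is_lattice_def)
  have fin: "finite B" using B(1) by (rule independent_imp_finite)
  let ?S = "{w \<in> N. norm w \<le> r}"
  \<comment> \<open>Cauchy-Schwarz bounds each coordinate by the norm of its dual vector times
    \<open>r\<close>; summing these norms gives one bound for all coordinates.\<close>
  define K where "K = (\<Sum>b\<in>B. norm (dual_vec B b)) * r"
  let ?h = "\<lambda>w. restrict (\<lambda>b. dual_vec B b \<bullet> w) B"
  have "inj_on ?h ?S"
  proof (rule inj_onI)
    fix x y assume xy: "x \<in> ?S" "y \<in> ?S" "?h x = ?h y"
    then have sp: "x \<in> span B" "y \<in> span B"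
      using B(2) add_subgroup_hull_subset_span by blast+
    have "dual_vec B b \<bullet> x = dual_vec B b \<bullet> y" if "b \<in> B" for b
      using fun_cong[OF xy(3), of b] that by simp
    then show "x = y"
      using dual_vec_expansion[OF B(1) sp(1)] dual_vec_expansion[OF B(1) sp(2)] by simp
  qed
  moreover have "?h ` ?S \<subseteq> PiE B (\<lambda>_. {z \<in> \<int>. \<bar>z\<bar> \<le> K})"
  proof (intro image_subsetI restrict_PiE_iff[THEN iffD2] ballI CollectI conjI)
    fix w b assume w: "w \<in> ?S" and b: "b \<in> B"
    show "dual_vec B b \<bullet> w \<in> \<int>"
      using w dual_vec_in_dual_lattice[OF B] by (auto simp: dual_lattice_def)
    have "\<bar>dual_vec B b \<bullet> w\<bar> \<le> norm (dual_vec B b) * norm w"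
      by (rule Cauchy_Schwarz_ineq2)
    also have "\<dots> \<le> K" unfolding K_def
      using w b fin by (intro mult_mono member_le_sum sum_nonneg) auto
    finally show "\<bar>dual_vec B b \<bullet> w\<bar> \<le> K" .
  qed
  moreover have "finite (PiE B (\<lambda>_. {z::real. z \<in> \<int> \<and> \<bar>z\<bar> \<le> K}))"
    using fin by (intro finite_PiE) (auto simp: finite_abs_int_segment)
  ultimately show ?thesis by (meson inj_on_finite)
qed

text \<open>The numbers \<open>u \<bullet> v\<close> form a subgroup of \<open>\<int>\<close>. Its positive generator \<open>c\<close> divides \<open>v\<close> in \<open>N\<close> by
  biduality.\<close>

lemma primitive_dual_eq_1:
  assumes "is_lattice N" "primitive N v"
  obtains s where "s \<in> dual_lattice N" "s \<bullet> v = 1"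
proof -
  have v: "v \<in> N" "v \<noteq> 0" using assms(2) by (auto simp: primitive_def)
  let ?M = "dual_lattice N"
  have int: "u \<bullet> v \<in> \<int>" if "u \<in> ?M" for u using that v by (auto simp: dual_lattice_def)
  obtain u0 where u0: "u0 \<in> ?M" "u0 \<bullet> v \<noteq> 0"
    using lattice_eq_0_if_dual_0[OF assms(1)] v by (metis span_base)
  define P where "P n \<longleftrightarrow> 0 < n \<and> (\<exists>u\<in>?M. u \<bullet> v = of_nat n)" for n :: nat
  have "\<exists>n. P n"
  proof -
    obtain z where z: "u0 \<bullet> v = of_int z" using int[OF u0(1)] by (auto elim: Ints_cases)
    have "P (nat \<bar>z\<bar>)"
    proof (cases "z \<ge> 0")
      case True
      then show ?thesis using u0 z by (auto simp: P_def intro!: bexI[of _ u0])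
    next
      case False
      then show ?thesis using u0 z dual_lattice_add_subgroup[of N]
        by (auto simp: P_def intro!: bexI[of _ "- u0"] add_subgroup_uminus)
    qed
    then show ?thesis ..
  qed
  define c where "c = (LEAST n. P n)"
  have "P c" unfolding c_def using \<open>\<exists>n. P n\<close> by (rule LeastI_ex)
  have c_le: "c \<le> n" if "P n" for n unfolding c_def using that by (rule Least_le)
  obtain s where s: "s \<in> ?M" "s \<bullet> v = of_nat c" and "c > 0"
    using \<open>P c\<close> by (auto simp: P_def)
  \<comment> \<open>Division with remainder: subtracting a multiple of \<open>s\<close> from
    \<open>u\<close> leaves an element with value \<open>z mod c\<close> at \<open>v\<close>, and
    minimality of \<open>c\<close> rules out a positive remainder.\<close>
  have "u \<bullet> ((1 / c) *\<^sub>R v) \<in> \<int>" if u: "u \<in> ?M" for u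
  proof -
    obtain z where z: "u \<bullet> v = of_int z" using int[OF u] by (auto elim: Ints_cases)
    define y where "y = u - of_int (z div int c) *\<^sub>R s"
    have "y \<in> ?M" unfolding y_def
      using u s(1) dual_lattice_add_subgroup by (intro add_subgroup_diff add_subgroup_scale_int)
    have yv: "y \<bullet> v = of_int (z mod int c)"
      by (simp add: y_def inner_diff_left z s(2) minus_div_mult_eq_mod[symmetric])
    have zc: "0 \<le> z mod int c" "z mod int c < int c" using \<open>c > 0\<close> by auto
    have "z mod int c = 0"
    proof (rule ccontr)
      assume "z mod int c \<noteq> 0"
      then have "0 < nat (z mod int c)" "of_nat (nat (z mod int c)) = y \<bullet> v"
        using zc yv by simp_all
      then have "P (nat (z mod int c))"
        using \<open>y \<in> ?M\<close> unfolding P_def by metis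
      then have "c \<le> nat (z mod int c)" by (rule c_le)
      with zc show False by linarith
    qed
    then have "z = int c * (z div int c)" using mult_div_mod_eq[of "int c" z] by (simp only: add_0_right)
    then have "of_int z = real c * of_int (z div int c)"
      by (metis of_int_mult of_int_of_nat_eq)
    then have "u \<bullet> ((1 / c) *\<^sub>R v) = of_int (z div int c)"
      using \<open>c > 0\<close> by (simp only: z inner_scaleR_right) simp
    then show ?thesis by (simp only: Ints_of_int)
  qed
  then have cN: "(1 / c) *\<^sub>R v \<in> N"
    using assms(1) v by (metis in_lattice_if_dual_integral span_base span_scale)
  have "of_int (int c) * (1 / real c) = 1" using \<open>c > 0\<close> by simp
  then have vc: "v = of_int (int c) *\<^sub>R ((1 / c) *\<^sub>R v)"
    by (simp only: scaleR_scaleR scaleR_one)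
  \<comment> \<open>Primitivity, applied to \<open>v\<close> as \<open>c\<close> times the lattice
    vector \<open>(1 / c) *\<^sub>R v\<close>, forces \<open>c = 1\<close>.\<close>
  have "\<forall>w\<in>N. \<forall>m. v = of_int m *\<^sub>R w \<longrightarrow> \<bar>m\<bar> = 1"
    using assms(2) unfolding primitive_def by blast
  from this[rule_format, OF cN vc] have "\<bar>int c\<bar> = 1" .
  then have "s \<bullet> v = 1" using s(2) by linarith
  with s(1) show thesis by (rule that)
qed

text \<open>Take the largest \<open>n\<close> with \<open>x / n\<close> in \<open>N\<close>. It
  exists because these quotients are distinct lattice points in the ball of radius
  \<open>norm x\<close>.\<close>

lemma exists_primitive:
  assumes "is_lattice N" "x \<in> N" "x \<noteq> 0"
  obtains v c where "primitive N v" "c > 0" "x = c *\<^sub>R v"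
proof -
  define P where "P n \<longleftrightarrow> n > 0 \<and> (1 / of_nat n) *\<^sub>R x \<in> N" for n :: nat
  let ?S = "{w \<in> N. norm w \<le> norm x}"
  have "finite (Collect P)"
  proof (rule inj_on_finite)
    show "finite ?S" using assms(1) by (rule finite_lattice_bounded)
    show "(\<lambda>n. (1 / of_nat n) *\<^sub>R x) ` Collect P \<subseteq> ?S"
    proof (safe)
      fix n assume "P n"
      then show "(1 / real n) *\<^sub>R x \<in> N" by (simp add: P_def)
      have "norm x * 1 \<le> norm x * n" using \<open>P n\<close> by (intro mult_left_mono) (auto simp: P_def)
      then show "norm ((1 / real n) *\<^sub>R x) \<le> norm x" using \<open>P n\<close> by (simp add: P_def field_simps)
    qed
    show "inj_on (\<lambda>n. (1 / of_nat n) *\<^sub>R x) (Collect P)"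
      using assms(3) by (auto simp: inj_on_def P_def)
  qed
  moreover have "P 1" using assms by (simp add: P_def)
  ultimately have "P (Max (Collect P))" and mx: "\<And>n. P n \<Longrightarrow> n \<le> Max (Collect P)"
    using Max_in[of "Collect P"] by auto
  define c where "c = Max (Collect P)"
  define v where "v = (1 / of_nat c) *\<^sub>R x"
  have c: "c > 0" "v \<in> N" using \<open>P (Max (Collect P))\<close> by (simp_all add: P_def c_def v_def)
  have xv: "x = of_nat c *\<^sub>R v" using c by (simp add: v_def)
  have "\<bar>m\<bar> = 1" if w: "w \<in> N" and vw: "v = of_int m *\<^sub>R w" for w and m :: int
  proof -
    have "m \<noteq> 0" using vw xv assms(3) by auto
    \<comment> \<open>Moving the sign of \<open>m\<close> into the lattice vector leaves a positive
      factor. Then \<open>x\<close> is divisible by \<open>c * \<bar>m\<bar>\<close>, and maximality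
      of \<open>c\<close> yields \<open>\<bar>m\<bar> = 1\<close>.\<close>
    define w' where "w' = of_int (sgn m) *\<^sub>R w"
    have w': "w' \<in> N" unfolding w'_def
      using assms(1) w by (intro add_subgroup_scale_int lattice_add_subgroup)
    have vw': "v = of_nat (nat \<bar>m\<bar>) *\<^sub>R w'"
    proof -
      have "real (nat \<bar>m\<bar>) * real_of_int (sgn m) = real_of_int (\<bar>m\<bar> * sgn m)" by simp
      also have "\<dots> = real_of_int m" by (simp only: abs_mult_sgn)
      finally show ?thesis by (simp only: w'_def vw scaleR_scaleR)
    qed
    have "x = of_nat (c * nat \<bar>m\<bar>) *\<^sub>R w'"
      unfolding xv vw' by (simp only: scaleR_scaleR of_nat_mult)
    then have "P (c * nat \<bar>m\<bar>)" using c w' \<open>m \<noteq> 0\<close> by (simp add: P_def)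
    from mx[OF this] have "c * nat \<bar>m\<bar> \<le> c * 1" by (simp add: c_def)
    then have "nat \<bar>m\<bar> \<le> 1" using c by (simp only: mult_le_cancel1)
    with \<open>m \<noteq> 0\<close> show ?thesis by linarith
  qed
  then have "primitive N v" using c xv assms(3) by (auto simp: primitive_def)
  with that[of v "real c"] c xv show thesis by simp
qed

section \<open>Rays of a complete fan\<close>

lemma convex_cone_hull_singleton:
  "convex_cone hull {x} = {c *\<^sub>R x | c. 0 \<le> c}"
  by (subst convex_cone_hull_convex_hull) force

lemma convex_cone_hull_insertE:
  assumes "y \<in> convex_cone hull (insert x T)"
  obtains c t where "0 \<le> c" "t \<in> convex_cone hull T" "y = c *\<^sub>R x + t"
  using assms convex_cone_hull_Un[of "{x}" T]
  by (auto simp: convex_cone_hull_singleton)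

lemma strongly_convexD:
  assumes "strongly_convex \<sigma>" "y \<in> \<sigma>" "- y \<in> \<sigma>"
  shows "y = 0"
proof -
  have "y \<in> \<sigma> \<inter> uminus ` \<sigma>" using assms(2,3) by (auto intro: image_eqI[of _ _ "- y"])
  then show ?thesis using assms(1) unfolding strongly_convex_def by blast
qed

text \<open>If 0 is interior to a segment with endpoints in \<open>\<sigma>\<close>, positive
  multiples of the endpoints are opposite to each other, and strong convexity makes both
  vanish.\<close>

lemma zero_face_of_strongly_convex:
  assumes "convex_cone \<sigma>" "strongly_convex \<sigma>"
  shows "{0} face_of \<sigma>"
  unfolding face_of_def
proof (intro conjI ballI impI)
  show "{0} \<subseteq> \<sigma>" using assms(1) by (simp add: convex_cone_contains_0)
  fix a b z assume ab: "a \<in> \<sigma>" "b \<in> \<sigma>" and z: "z \<in> {0}" "z \<in> open_segment a b"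
  obtain u where u: "0 < u" "u < 1" "0 = (1 - u) *\<^sub>R a + u *\<^sub>R b"
    using z by (auto simp: in_segment)
  have "(1 - u) *\<^sub>R a \<in> \<sigma>" "u *\<^sub>R b \<in> \<sigma>"
    using assms(1) ab u by (simp_all add: convex_cone_scaleR)
  moreover have "u *\<^sub>R b = - ((1 - u) *\<^sub>R a)"
    using u(3) by (metis add.commute add_eq_0_iff)
  ultimately have "(1 - u) *\<^sub>R a = 0" "u *\<^sub>R b = 0"
    using strongly_convexD[OF assms(2), of "(1 - u) *\<^sub>R a"] by auto
  then show "a \<in> {0}" "b \<in> {0}" using u by auto
qed auto

text \<open>For a segment that meets the ray in an interior point, split both endpoints into a
  multiple of \<open>x\<close> and a part from \<open>T\<close>; the parts combine to
  \<open>\<gamma> *\<^sub>R x\<close>. Irredundancy of \<open>x\<close> excludes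
  \<open>\<gamma> > 0\<close>, and for \<open>\<gamma> \<le> 0\<close> strong convexity makes the
  parts vanish.\<close>

lemma extremal_generator_face_of:
  assumes "strongly_convex (convex_cone hull (insert x T))" "x \<notin> convex_cone hull T"
  shows "(convex_cone hull {x}) face_of (convex_cone hull (insert x T))"
  unfolding face_of_def
proof (intro conjI ballI impI)
  let ?\<sigma> = "convex_cone hull (insert x T)"
  have T_sub: "convex_cone hull T \<subseteq> ?\<sigma>" by (intro hull_mono) auto
  have cc: "convex_cone ?\<sigma>" "convex_cone (convex_cone hull T)"
    by (rule convex_cone_convex_cone_hull)+
  have x: "x \<in> ?\<sigma>" by (simp add: hull_inc)
  show "convex_cone hull {x} \<subseteq> ?\<sigma>" by (intro hull_mono) auto
  show "convex (convex_cone hull {x})" by (rule convex_convex_cone_hull)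
  fix a b z
  assume ab: "a \<in> ?\<sigma>" "b \<in> ?\<sigma>" and z: "z \<in> convex_cone hull {x}" "z \<in> open_segment a b"
  obtain u where u: "0 < u" "u < 1" "z = (1 - u) *\<^sub>R a + u *\<^sub>R b"
    using z by (auto simp: in_segment)
  obtain c where c: "z = c *\<^sub>R x" using z(1) by (auto simp: convex_cone_hull_singleton)
  obtain \<alpha> a' where a: "0 \<le> \<alpha>" "a' \<in> convex_cone hull T" "a = \<alpha> *\<^sub>R x + a'"
    using ab(1) by (rule convex_cone_hull_insertE)
  obtain \<beta> b' where b: "0 \<le> \<beta>" "b' \<in> convex_cone hull T" "b = \<beta> *\<^sub>R x + b'"
    using ab(2) by (rule convex_cone_hull_insertE)
  define \<gamma> where "\<gamma> = c - (1 - u) * \<alpha> - u * \<beta>"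
  define t where "t = (1 - u) *\<^sub>R a' + u *\<^sub>R b'"
  have ua': "(1 - u) *\<^sub>R a' \<in> convex_cone hull T" and ub': "u *\<^sub>R b' \<in> convex_cone hull T"
    using a b u cc(2) by (auto intro: convex_cone_scaleR)
  then have t: "t \<in> convex_cone hull T" unfolding t_def by (intro convex_cone_add cc)
  have "c *\<^sub>R x = (1 - u) *\<^sub>R (\<alpha> *\<^sub>R x + a') + u *\<^sub>R (\<beta> *\<^sub>R x + b')"
    using c u(3) a(3) b(3) by simp
  then have \<gamma>t: "\<gamma> *\<^sub>R x = t"
    by (simp add: \<gamma>_def t_def algebra_simps)
  have "\<gamma> \<le> 0"
  proof (rule ccontr)
    assume "\<not> \<gamma> \<le> 0"
    then have "x = (1 / \<gamma>) *\<^sub>R t" by (simp flip: \<gamma>t)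
    also have "\<dots> \<in> convex_cone hull T"
      using \<open>\<not> \<gamma> \<le> 0\<close> t cc(2) by (auto intro: convex_cone_scaleR)
    finally show False using assms(2) by contradiction
  qed
  then have \<gamma>x: "(- \<gamma>) *\<^sub>R x \<in> ?\<sigma>" using cc(1) x by (intro convex_cone_scaleR) auto
  \<comment> \<open>The negative of one part is again in the cone, as the sum of the other part and
    \<open>(- \<gamma>) *\<^sub>R x\<close>.\<close>
  have "- ((1 - u) *\<^sub>R a') = u *\<^sub>R b' + (- \<gamma>) *\<^sub>R x"
    using \<gamma>t by (simp add: t_def algebra_simps)
  also have "\<dots> \<in> ?\<sigma>" using \<gamma>x ub' T_sub by (intro convex_cone_add cc) auto
  finally have "(1 - u) *\<^sub>R a' = 0" using strongly_convexD[OF assms(1)] ua' T_sub by blast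
  then have "a' = 0" using u by simp
  have "- (u *\<^sub>R b') = (1 - u) *\<^sub>R a' + (- \<gamma>) *\<^sub>R x"
    using \<gamma>t by (simp add: t_def algebra_simps)
  also have "\<dots> \<in> ?\<sigma>" using \<gamma>x ua' T_sub by (intro convex_cone_add cc) auto
  finally have "u *\<^sub>R b' = 0" using strongly_convexD[OF assms(1)] ub' T_sub by blast
  then have "b' = 0" using u by simp
  with \<open>a' = 0\<close> a b show "a \<in> convex_cone hull {x}" "b \<in> convex_cone hull {x}"
    by (auto simp: convex_cone_hull_singleton)
qed

text \<open>A generating set of least cardinality has no redundant element, so each of its elements
  spans a face of \<open>\<sigma>\<close>. This face is a ray of the fan, and the element is a
  positive multiple of its primitive generator.\<close>

lemma cone_subset_span_ray_generators:
  assumes "is_lattice N" "fan N \<Sigma>" "\<sigma> \<in> \<Sigma>"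
  shows "\<sigma> \<subseteq> span (ray_generators N \<Sigma>)"
proof -
  define P where "P S \<longleftrightarrow> finite S \<and> S \<subseteq> N \<and> \<sigma> = convex_cone hull S" for S
  have "\<exists>S. P S" using assms(2,3) by (auto simp: fan_def rational_cone_def P_def)
  then obtain S where S: "P S" and least: "\<And>T. P T \<Longrightarrow> card S \<le> card T"
    using ex_has_least_nat[of P _ card] by metis
  have sc: "strongly_convex \<sigma>" using assms(2,3) by (auto simp: fan_def)
  have "x \<in> span (ray_generators N \<Sigma>)" if x: "x \<in> S" for x
  proof -
    have ins: "insert x (S - {x}) = S" using x by auto
    have notin: "x \<notin> convex_cone hull (S - {x})"
    proof
      assume "x \<in> convex_cone hull (S - {x})"
      then have "convex_cone hull (insert x (S - {x})) = convex_cone hull (S - {x})"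
        by (rule hull_redundant)
      then have "P (S - {x})" using S unfolding P_def ins by (metis finite_Diff subset_trans Diff_subset)
      then have "card S \<le> card (S - {x})" by (rule least)
      moreover have "card (S - {x}) < card S" using S x by (intro psubset_card_mono) (auto simp: P_def)
      ultimately show False by simp
    qed
    then have "x \<noteq> 0" using convex_cone_hull_contains_0 by metis
    have "strongly_convex (convex_cone hull insert x (S - {x}))"
      using sc S by (simp add: ins P_def del: insert_Diff_single)
    from extremal_generator_face_of[OF this notin] have "(convex_cone hull {x}) face_of \<sigma>"
      using S by (simp add: ins P_def del: insert_Diff_single)
    then have ray: "convex_cone hull {x} \<in> \<Sigma>"
      using assms(2,3) convex_cone_hull_nonempty unfolding fan_def by metis
    have "x \<in> N" using S x by (auto simp: P_def)
    then obtain v c where v: "primitive N v" "c > 0" "x = c *\<^sub>R v"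
      using exists_primitive[OF assms(1) _ \<open>x \<noteq> 0\<close>] by metis
    have "convex_cone hull {v} = convex_cone hull {x}"
    proof (rule hull_unique)
      show "{v} \<subseteq> convex_cone hull {x}"
        using v by (auto simp: convex_cone_hull_singleton intro!: exI[of _ "1 / c"])
      show "convex_cone hull {x} \<subseteq> t" if "{v} \<subseteq> t" "convex_cone t" for t
        using that v by (intro hull_minimal) (auto intro: convex_cone_scaleR)
    qed (rule convex_cone_convex_cone_hull)
    then have "v \<in> ray_generators N \<Sigma>" using ray v by (simp add: ray_generators_def)
    then show ?thesis using v by (simp add: span_base span_scale)
  qed
  then have "convex_cone hull S \<subseteq> span (ray_generators N \<Sigma>)"
    by (intro hull_minimal convex_cone_span) auto
  then show ?thesis using S by (simp add: P_def)
qed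

text \<open>Completeness enters here: the cones cover \<open>span N\<close>, and each cone lies in
  the span of the ray generators.\<close>

lemma span_ray_generators:
  assumes "is_lattice N" "complete_fan N \<Sigma>"
  shows "span (ray_generators N \<Sigma>) = span N"
proof
  show "span (ray_generators N \<Sigma>) \<subseteq> span N"
    by (intro span_mono) (auto simp: ray_generators_def primitive_def)
  have "\<Union>\<Sigma> \<subseteq> span (ray_generators N \<Sigma>)"
    using assms cone_subset_span_ray_generators unfolding complete_fan_def by (intro Union_least) blast
  then show "span N \<subseteq> span (ray_generators N \<Sigma>)"
    using assms(2) by (simp add: complete_fan_def)
qed

text \<open>Supplies the chart of the open torus. Completeness guarantees that some cone exists, and
  the zero cone is a face of it.\<close>

lemma zero_cone_in_complete_fan:
  assumes "complete_fan N \<Sigma>"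
  shows "{0} \<in> \<Sigma>"
proof -
  have "0 \<in> \<Union>\<Sigma>" using assms by (simp add: complete_fan_def span_zero)
  then obtain \<sigma> where \<sigma>: "\<sigma> \<in> \<Sigma>" by auto
  have "convex_cone \<sigma>" "strongly_convex \<sigma>"
    using assms \<sigma> by (auto simp: complete_fan_def fan_def rational_cone_def convex_cone_convex_cone_hull)
  then have "{0} face_of \<sigma>" by (rule zero_face_of_strongly_convex)
  then show ?thesis using assms \<sigma> unfolding complete_fan_def fan_def by (metis insert_not_empty)
qed

section \<open>Two-regularity\<close>

text \<open>Pigeonhole principle: subtracting from the multiples of \<open>w\<close> the integral parts of their
  coordinates leaves only finitely many lattice points.\<close>

lemma exists_multiple_dual_vec_integral:
  assumes "is_lattice N" "B \<subseteq> N" "independent B" "w \<in> N" "w \<in> span B" "b \<in> B"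
  obtains k where "k > (0::nat)" "of_nat k * (dual_vec B b \<bullet> w) \<in> \<int>"
proof -
  have fin: "finite B" using assms(3) by (rule independent_imp_finite)
  have sub: "add_subgroup N" using assms(1) by (rule lattice_add_subgroup)
  define f where "f k = of_nat k *\<^sub>R w - (\<Sum>v\<in>B. of_int \<lfloor>of_nat k * (dual_vec B v \<bullet> w)\<rfloor> *\<^sub>R v)" for k :: nat
  have f_eq: "f k = (\<Sum>v\<in>B. frac (of_nat k * (dual_vec B v \<bullet> w)) *\<^sub>R v)" for k
  proof -
    have "of_nat k *\<^sub>R w = (\<Sum>v\<in>B. (of_nat k * (dual_vec B v \<bullet> w)) *\<^sub>R v)"
      by (subst dual_vec_expansion[OF assms(3,5)]) (simp add: scaleR_sum_right)
    then show ?thesis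
      by (simp add: f_def frac_def scaleR_diff_left sum_subtractf)
  qed
  have "range f \<subseteq> {w \<in> N. norm w \<le> (\<Sum>v\<in>B. norm v)}"
  proof safe
    fix k
    show "f k \<in> N" unfolding f_def using assms(2,4)
      by (intro add_subgroup_diff add_subgroup_sum add_subgroup_scale_int add_subgroup_scale_nat sub) auto
    have "norm (f k) \<le> (\<Sum>v\<in>B. norm (frac (of_nat k * (dual_vec B v \<bullet> w)) *\<^sub>R v))"
      unfolding f_eq by (rule norm_sum)
    also have "\<dots> \<le> (\<Sum>v\<in>B. 1 * norm v)"
      unfolding norm_scaleR
      by (intro sum_mono mult_right_mono) (auto simp: less_imp_le[OF frac_lt_1])
    finally show "norm (f k) \<le> (\<Sum>v\<in>B. norm v)" by simp
  qed
  then have "finite (range f)" using finite_lattice_bounded[OF assms(1)] by (rule finite_subset)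
  then have "\<not> inj f" using range_inj_infinite by blast
  then obtain i j where "i < j" "f i = f j"
    by (metis injI linorder_neqE_nat)
  have "dual_vec B b \<bullet> f k = frac (of_nat k * (dual_vec B b \<bullet> w))" for k
  proof -
    have "dual_vec B b \<bullet> f k =
        (\<Sum>v\<in>B. if v = b then frac (of_nat k * (dual_vec B v \<bullet> w)) else 0)"
      unfolding f_eq inner_sum_right
      by (intro sum.cong) (auto simp: inner_dual_vec[OF assms(3)])
    then show ?thesis using fin assms(6) by simp
  qed
  then have "frac (of_nat i * (dual_vec B b \<bullet> w)) = frac (of_nat j * (dual_vec B b \<bullet> w))"
    using \<open>f i = f j\<close> by metis
  \<comment> \<open>Equal fractional parts mean that the difference of the two multiples is
    integral, so \<open>j - i\<close> serves as \<open>k\<close>.\<close>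
  then have "of_nat (j - i) * (dual_vec B b \<bullet> w) =
      of_int (\<lfloor>of_nat j * (dual_vec B b \<bullet> w)\<rfloor> - \<lfloor>of_nat i * (dual_vec B b \<bullet> w)\<rfloor>)"
    using \<open>i < j\<close> by (simp add: frac_def of_nat_diff algebra_simps)
  then have "of_nat (j - i) * (dual_vec B b \<bullet> w) \<in> \<int>" by (metis Ints_of_int)
  with that[of "j - i"] \<open>i < j\<close> show thesis by simp
qed

text \<open>Clear the denominators on each element of a lattice basis \<open>B0\<close> and multiply
  the factors together.\<close>

lemma exists_multiple_dual_vec_in_dual_lattice:
  assumes "is_lattice N" "B \<subseteq> N" "independent B" "span B = span N" "b \<in> B"
  obtains k where "k > (0::nat)" "of_nat k *\<^sub>R dual_vec B b \<in> dual_lattice N"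
proof -
  obtain B0 where B0: "independent B0" "N = add_subgroup hull B0"
    using assms(1) by (auto simp: is_lattice_def)
  have fin: "finite B0" using B0(1) by (rule independent_imp_finite)
  have B0N: "B0 \<subseteq> N" unfolding B0(2) by (rule hull_subset)
  have "\<forall>w\<in>B0. \<exists>k>0. of_nat k * (dual_vec B b \<bullet> w) \<in> \<int>"
  proof
    fix w assume "w \<in> B0"
    then have "w \<in> N" "w \<in> span B" using B0N assms(4) by (auto simp: span_base)
    then show "\<exists>k>0. of_nat k * (dual_vec B b \<bullet> w) \<in> \<int>"
      using exists_multiple_dual_vec_integral[OF assms(1-3) _ _ assms(5)] by metis
  qed
  then obtain \<kappa> where \<kappa>: "\<And>w. w \<in> B0 \<Longrightarrow> \<kappa> w > 0 \<and> of_nat (\<kappa> w) * (dual_vec B b \<bullet> w) \<in> \<int>"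
    by metis
  define k where "k = prod \<kappa> B0"
  have "k > 0" unfolding k_def using \<kappa> by (intro prod_pos) auto
  let ?u = "of_nat k *\<^sub>R dual_vec B b"
  have "add_subgroup {v. ?u \<bullet> v \<in> \<int>}" unfolding add_subgroup_def
    by (simp add: inner_diff_right right_diff_distrib del: inner_scaleR_left)
  moreover have "B0 \<subseteq> {v. ?u \<bullet> v \<in> \<int>}"
  proof safe
    fix w assume w: "w \<in> B0"
    have "k = \<kappa> w * prod \<kappa> (B0 - {w})" unfolding k_def using fin w by (rule prod.remove)
    then have "?u \<bullet> w = of_nat (prod \<kappa> (B0 - {w})) * (of_nat (\<kappa> w) * (dual_vec B b \<bullet> w))"
      by simp
    also have "\<dots> \<in> \<int>" using \<kappa>[OF w] by (rule Ints_mult[OF Ints_of_nat conjunct2])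
    finally show "?u \<bullet> w \<in> \<int>" .
  qed
  ultimately have "N \<subseteq> {v. ?u \<bullet> v \<in> \<int>}" unfolding B0(2) by (rule hull_minimal[rotated])
  moreover have "?u \<in> span N"
    using dual_vec_span[OF assms(3)] assms(4) by (simp add: span_scale)
  ultimately have "?u \<in> dual_lattice N" by (auto simp: dual_lattice_def)
  with that \<open>k > 0\<close> show thesis by blast
qed

text \<open>Any integer at distance less than 1 from such a \<open>j * d / q\<close> lies strictly
  between 0 and \<open>d\<close>, which will contradict the minimality of \<open>d\<close>. For
  \<open>q \<le> d\<close> take \<open>j = 1\<close>; otherwise take the first multiple of
  \<open>d\<close> that is at least \<open>q\<close>, which is below
  \<open>q + d < 2 * q \<le> (d - 1) * q\<close>.\<close>

lemma exists_multiple_between: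
  fixes q d :: nat
  assumes "2 \<le> q" "3 \<le> d"
  obtains j :: nat where "1 \<le> real j * d / q" "real j * d / q \<le> real d - 1"
proof (cases "q \<le> d")
  case True
  have "real d / q \<le> real d / 2" using assms by (intro divide_left_mono) auto
  also have "\<dots> \<le> real d - 1" using assms by simp
  finally show thesis using that[of 1] True assms by simp
next
  case False
  define j where "j = nat \<lceil>real q / d\<rceil>"
  have "real q / d \<le> j" "j < real q / d + 1"
    unfolding j_def using assms by (simp_all add: of_nat_nat) linarith+
  then have "q \<le> real j * d" "real j * d < real q + d" using assms by (simp_all add: field_simps)
  moreover have "real q + d < 2 * real q" using False by simp
  moreover have "2 * real q \<le> (real d - 1) * q" using assms by (intro mult_right_mono) auto
  ultimately have "q \<le> real j * d" "real j * d \<le> (real d - 1) * q" by linarith+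
  then have "1 \<le> real j * d / q" "real j * d / q \<le> real d - 1"
    using assms by (simp_all add: pos_divide_le_eq pos_le_divide_eq)
  then show thesis by (rule that)
qed

text \<open>The inequalities at the elements of \<open>B\<close> determine all dual-basis
  coordinates of the representative of \<open>(j * d / q) *\<^sub>R dual_vec B b\<close>.\<close>

lemma twice_dual_vec_in_dual_lattice:
  assumes N: "is_lattice N" and B: "B \<subseteq> N" "independent B" "span B = span N" "b \<in> B"
    and q: "2 \<le> (q::nat)"
    and rep: "\<And>m. m \<in> dual_lattice N \<Longrightarrow>
      \<exists>m'\<in>dual_lattice N. \<forall>v\<in>B. \<bar>((1 / q) *\<^sub>R m - m') \<bullet> v\<bar> < 1"
  shows "2 *\<^sub>R dual_vec B b \<in> dual_lattice N"
proof -
  let ?M = "dual_lattice N" and ?e = "dual_vec B b"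
  define P where "P k \<longleftrightarrow> 0 < k \<and> of_nat k *\<^sub>R ?e \<in> ?M" for k :: nat
  define d where "d = (LEAST k. P k)"
  have "\<exists>k. P k"
    using exists_multiple_dual_vec_in_dual_lattice[OF N B] unfolding P_def by metis
  then have "P d" unfolding d_def by (rule LeastI_ex)
  then have d: "d > 0" "of_nat d *\<^sub>R ?e \<in> ?M" by (auto simp: P_def)
  have least: "d \<le> k" if "P k" for k unfolding d_def using that by (rule Least_le)
  have "d < 3"
  proof (rule ccontr)
    assume "\<not> d < 3"
    then obtain j :: nat where j: "1 \<le> real j * d / q" "real j * d / q \<le> real d - 1"
      using exists_multiple_between[OF q, of d] by auto
    have "of_nat j *\<^sub>R of_nat d *\<^sub>R ?e \<in> ?M"
      by (rule add_subgroup_scale_nat[OF dual_lattice_add_subgroup d(2)])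
    from rep[OF this] obtain m where m: "m \<in> ?M"
      "\<And>v. v \<in> B \<Longrightarrow> \<bar>((1 / q) *\<^sub>R of_nat j *\<^sub>R of_nat d *\<^sub>R ?e - m) \<bullet> v\<bar> < 1"
      by metis
    have int: "m \<bullet> v \<in> \<int>" if "v \<in> B" for v using m(1) that B(1) by (auto simp: dual_lattice_def)
    have close: "\<bar>real j * d / q * (if v = b then 1 else 0) - m \<bullet> v\<bar> < 1" if "v \<in> B" for v
      using m(2)[OF that] inner_dual_vec[OF B(2) that, of b] by (simp add: inner_diff_left)
    obtain c where c: "m \<bullet> b = of_int c" using int[OF B(4)] by (auto elim: Ints_cases)
    have "\<bar>real j * d / q - of_int c\<bar> < 1" using close[OF B(4)] c by simp
    then have "0 < real_of_int c" "real_of_int c < of_nat d" using j by linarith+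
    then have c_bounds: "0 < c" "c < int d" by simp_all
    have "m \<bullet> v = (of_int c *\<^sub>R ?e) \<bullet> v" if v: "v \<in> B" for v
    proof (cases "v = b")
      case True
      then show ?thesis using c inner_dual_vec[OF B(2,4)] by simp
    next
      case False
      \<comment> \<open>At basis vectors other than \<open>b\<close> the point to be approximated
        pairs to 0, so the integer \<open>m \<bullet> v\<close> has absolute value below 1.\<close>
      obtain z where "m \<bullet> v = of_int z" using int[OF v] by (auto elim: Ints_cases)
      with False close[OF v] have "\<bar>real_of_int z\<bar> < 1" by simp
      then have "z = 0" by linarith
      with \<open>m \<bullet> v = of_int z\<close> False show ?thesis using inner_dual_vec[OF B(2) v] by simp
    qed
    moreover have "m \<in> span B" using m(1) B(3) by (simp add: dual_lattice_def)
    ultimately have "m = of_int c *\<^sub>R ?e"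
      using dual_vec_span[OF B(2)] by (intro span_eqI_inner[of m B]) (auto simp: span_scale)
    \<comment> \<open>Now \<open>c\<close> is a positive multiplier smaller than the least
      one.\<close>
    then have "P (nat c)" using m(1) c_bounds by (simp add: P_def)
    from least[OF this] c_bounds show False by linarith
  qed
  \<comment> \<open>For \<open>d = 1\<close> the vector \<open>?e\<close> itself lies in the dual
    lattice and gets doubled.\<close>
  then consider "d = 1" | "d = 2" using d(1) by linarith
  then show ?thesis
    using d(2) add_subgroup_scale_nat[OF dual_lattice_add_subgroup[of N], of ?e 2] by cases auto
qed

text \<open>A maximal independent subset of \<open>R\<close> spans the same space as
  \<open>R\<close>, so its dual basis gives coordinates on \<open>N\<close>. Those of
  \<open>2 *\<^sub>R w\<close> are the pairings of \<open>w\<close> with twice the dual vectors,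
  hence integral.\<close>

lemma two_regular_if_representatives:
  assumes N: "is_lattice N" and R: "R \<subseteq> N" "span R = span N" and q: "2 \<le> (q::nat)"
    and rep: "\<And>m. m \<in> dual_lattice N \<Longrightarrow>
      \<exists>m'\<in>dual_lattice N. \<forall>v\<in>R. \<bar>((1 / q) *\<^sub>R m - m') \<bullet> v\<bar> < 1"
  shows "k_regular 2 N R"
  unfolding k_regular_def
proof (intro allI impI ballI, elim conjE)
  fix B w
  assume B: "B \<subseteq> R" "independent B" and w: "w \<in> N"
    and max: "\<forall>C. B \<subseteq> C \<and> C \<subseteq> R \<and> independent C \<longrightarrow> C = B"
  have "R \<subseteq> span B"
  proof
    fix r assume "r \<in> R"
    show "r \<in> span B"
    proof (rule ccontr)
      assume "r \<notin> span B"
      then have "independent (insert r B)" using B by (simp add: independent_insert)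
      with max \<open>r \<in> R\<close> B have "insert r B = B" by blast
      with \<open>r \<notin> span B\<close> show False by (metis insertI1 span_base)
    qed
  qed
  then have span: "span B = span N"
    using R(2) B(1) by (metis span_mono span_span subset_antisym)
  have "dual_vec B b \<bullet> (2 *\<^sub>R w) \<in> \<int>" if "b \<in> B" for b
  proof -
    have "2 *\<^sub>R dual_vec B b \<in> dual_lattice N"
      using B R(1) rep by (intro twice_dual_vec_in_dual_lattice[OF N _ B(2) span that q]) blast+
    then show ?thesis using w by (auto simp: dual_lattice_def)
  qed
  then have "2 *\<^sub>R w \<in> add_subgroup hull B"
    using w by (intro add_subgroup_hull_integral_coords B) (auto simp: span span_base span_scale)
  then show "of_nat 2 *\<^sub>R w \<in> add_subgroup hull B" by simp
qed

section \<open>Group algebras\<close>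

lift_definition coeff :: "('v, 'k::zero) group_alg \<Rightarrow> 'v \<Rightarrow> 'k" is Poly_Mapping.lookup .

lift_definition single :: "'v \<Rightarrow> 'k::zero \<Rightarrow> ('v, 'k) group_alg" is Poly_Mapping.single .

abbreviation monom :: "'v \<Rightarrow> ('v, 'k::zero_neq_one) group_alg" where
  "monom u \<equiv> single u 1"

lemma group_alg_eqI: "(\<And>u. coeff f u = coeff g u) \<Longrightarrow> f = g"
  by transfer (rule poly_mapping_eqI)

lemma finite_exponents [simp]: "finite (exponents f)"
  by transfer simp

lemma in_exponents_iff: "u \<in> exponents f \<longleftrightarrow> coeff f u \<noteq> 0"
  by transfer (rule in_keys_iff)

lemma coeff_single: "coeff (single u c) w = (if w = u then c else 0)"
  by transfer (auto simp: lookup_single when_def)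

lemma coeff_zero [simp]: "coeff (0 :: ('v::comm_monoid_add, 'k::comm_ring_1) group_alg) u = 0"
  by transfer simp

lemma coeff_add [simp]:
  "coeff (f + g :: ('v::comm_monoid_add, 'k::comm_ring_1) group_alg) u = coeff f u + coeff g u"
  by transfer (rule lookup_add)

lemma coeff_diff [simp]:
  "coeff (f - g :: ('v::comm_monoid_add, 'k::comm_ring_1) group_alg) u = coeff f u - coeff g u"
  by transfer (rule lookup_minus)

lemma coeff_sum [simp]:
  "coeff (\<Sum>i\<in>I. f i :: ('v::comm_monoid_add, 'k::comm_ring_1) group_alg) u = (\<Sum>i\<in>I. coeff (f i) u)"
  by (induction I rule: infinite_finite_induct) simp_all

lemma monom_0: "(monom 0 :: ('v::comm_monoid_add, 'k::comm_ring_1) group_alg) = 1"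
  by transfer simp

lemma single_mult_single:
  "single u c * single w d = (single (u + w) (c * d) :: ('v::comm_monoid_add, 'k::comm_ring_1) group_alg)"
  by transfer (rule mult_single)

lemma monom_mult:
  "monom u * monom w = (monom (u + w) :: ('v::comm_monoid_add, 'k::comm_ring_1) group_alg)"
  by (simp add: single_mult_single)

lemma monom_neq_0 [simp]: "(monom u :: ('v::comm_monoid_add, 'k::comm_ring_1) group_alg) \<noteq> 0"
proof
  assume "(monom u :: ('v, 'k) group_alg) = 0"
  then have "coeff (monom u :: ('v, 'k) group_alg) u = 0" by simp
  then show False by (simp add: coeff_single)
qed

lemma exponents_monom [simp]:
  "exponents (monom u :: ('v, 'k::zero_neq_one) group_alg) = {u}"
  by (auto simp: in_exponents_iff coeff_single split: if_splits)

lemma exponents_0 [simp]: "exponents (0 :: ('v::comm_monoid_add, 'k::comm_ring_1) group_alg) = {}"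
  by (auto simp: in_exponents_iff)

lemma exponents_add:
  "exponents (f + g :: ('v::comm_monoid_add, 'k::comm_ring_1) group_alg) \<subseteq> exponents f \<union> exponents g"
  by (auto simp: in_exponents_iff)

lemma exponents_mult:
  assumes "c \<in> exponents (f * g :: ('v::comm_monoid_add, 'k::comm_ring_1) group_alg)"
  obtains a b where "a \<in> exponents f" "b \<in> exponents g" "c = a + b"
  using assms by transfer (use keys_mult in blast)

lemma group_alg_expansion:
  "f = (\<Sum>u\<in>exponents f. single u (coeff f u) :: ('v::comm_monoid_add, 'k::comm_ring_1) group_alg)"
  by (rule group_alg_eqI) (auto simp: coeff_single in_exponents_iff)

lemma coeff_monom_mult:
  "coeff (monom u * f :: ('v::ab_group_add, 'k::comm_ring_1) group_alg) w = coeff f (w - u)"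
proof -
  have "monom u * f = (\<Sum>a\<in>exponents f. single (u + a) (coeff f a))"
    by (subst group_alg_expansion[of f]) (simp add: sum_distrib_left single_mult_single)
  then have "coeff (monom u * f) w = (\<Sum>a\<in>exponents f. if a = w - u then coeff f a else 0)"
    by (auto simp: coeff_single algebra_simps intro!: sum.cong)
  then show ?thesis by (simp add: in_exponents_iff)
qed

lemma exponents_monom_mult:
  "exponents (monom u * f :: ('v::ab_group_add, 'k::comm_ring_1) group_alg) = (+) u ` exponents f"
proof (intro set_eqI)
  fix w
  have "w = u + (w - u)" by simp
  then show "w \<in> exponents (monom u * f) \<longleftrightarrow> w \<in> (+) u ` exponents f"
    by (auto simp: in_exponents_iff coeff_monom_mult image_iff intro!: bexI[of _ "w - u"])
qed

section \<open>Maps of group algebras induced by maps of exponents\<close>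

lemma alg_map_eq:
  "alg_map h f = (\<Sum>u\<in>exponents f. single (h u) (coeff f u)
    :: ('w::comm_monoid_add, 'k::comm_ring_1) group_alg)"
proof -
  have "to_pm (\<Sum>u\<in>U. single (h u) (coeff f u) :: ('w, 'k) group_alg) =
      (\<Sum>u\<in>U. Poly_Mapping.single (h u) (Poly_Mapping.lookup (to_pm f) u))" for U
    by (induction U rule: infinite_finite_induct)
      (simp_all add: zero_group_alg.rep_eq plus_group_alg.rep_eq single.rep_eq coeff.rep_eq)
  then show ?thesis
    by (simp flip: to_pm_inject add: alg_map.rep_eq exponents.rep_eq)
qed

text \<open>Allows a common index set for several elements, as in the proof of additivity; the extra
  coefficients vanish.\<close>

lemma alg_map_superset:
  assumes "finite U" "exponents f \<subseteq> U"
  shows "alg_map h f = (\<Sum>u\<in>U. single (h u) (coeff f u)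
    :: ('w::comm_monoid_add, 'k::comm_ring_1) group_alg)"
  unfolding alg_map_eq using assms
  by (intro sum.mono_neutral_left)
    (auto simp: in_exponents_iff coeff_single intro!: group_alg_eqI)

lemma single_add: "single u (c + d) = single u c + (single u d :: ('v::comm_monoid_add, 'k::comm_ring_1) group_alg)"
  by (rule group_alg_eqI) (simp add: coeff_single)

lemma alg_map_add:
  "alg_map h (f + g :: ('v::comm_monoid_add, 'k::comm_ring_1) group_alg) =
    (alg_map h f + alg_map h g :: ('w::comm_monoid_add, 'k) group_alg)"
proof -
  let ?U = "exponents f \<union> exponents g"
  have "alg_map h (f + g) = (\<Sum>u\<in>?U. single (h u) (coeff (f + g) u) :: ('w, 'k) group_alg)"
    using exponents_add by (intro alg_map_superset) auto
  also have "\<dots> = (\<Sum>u\<in>?U. single (h u) (coeff f u)) + (\<Sum>u\<in>?U. single (h u) (coeff g u))"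
    by (simp add: single_add sum.distrib)
  also have "(\<Sum>u\<in>?U. single (h u) (coeff f u)) = (alg_map h f :: ('w, 'k) group_alg)"
    by (intro alg_map_superset[symmetric]) auto
  also have "(\<Sum>u\<in>?U. single (h u) (coeff g u)) = (alg_map h g :: ('w, 'k) group_alg)"
    by (intro alg_map_superset[symmetric]) auto
  finally show ?thesis .
qed

lemma alg_map_0 [simp]:
  "alg_map h (0 :: ('v::comm_monoid_add, 'k::comm_ring_1) group_alg) = (0 :: ('w::comm_monoid_add, 'k) group_alg)"
  by (simp add: alg_map_eq)

lemma alg_map_single [simp]:
  "alg_map h (single u c :: ('v::comm_monoid_add, 'k::comm_ring_1) group_alg) =
    (single (h u) c :: ('w::comm_monoid_add, 'k) group_alg)"
proof -
  have "alg_map h (single u c) = (\<Sum>w\<in>{u}. single (h w) (coeff (single u c) w) :: ('w, 'k) group_alg)"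
    by (rule alg_map_superset) (auto simp: in_exponents_iff coeff_single split: if_splits)
  then show ?thesis by (simp add: coeff_single)
qed

lemma alg_map_sum:
  "alg_map h (\<Sum>i\<in>I. f i :: ('v::comm_monoid_add, 'k::comm_ring_1) group_alg) =
    (\<Sum>i\<in>I. alg_map h (f i) :: ('w::comm_monoid_add, 'k) group_alg)"
  by (induction I rule: infinite_finite_induct) (simp_all add: alg_map_add)

lemma alg_map_diff:
  "alg_map h (f - g :: ('v::comm_monoid_add, 'k::comm_ring_1) group_alg) =
    (alg_map h f - alg_map h g :: ('w::comm_monoid_add, 'k) group_alg)"
  using alg_map_add[of h "f - g" g] by (simp add: algebra_simps)

lemma alg_map_1:
  assumes "h 0 = 0"
  shows "alg_map h (1 :: ('v::comm_monoid_add, 'k::comm_ring_1) group_alg) =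
    (1 :: ('w::comm_monoid_add, 'k) group_alg)"
  using assms by (simp flip: monom_0)

lemma alg_map_mult:
  assumes "\<And>u w. h (u + w) = h u + h w"
  shows "alg_map h (f * g :: ('v::comm_monoid_add, 'k::comm_ring_1) group_alg) =
    (alg_map h f * alg_map h g :: ('w::comm_monoid_add, 'k) group_alg)"
proof -
  let ?F = "exponents f" and ?G = "exponents g"
  have "alg_map h (f * g) =
      alg_map h ((\<Sum>u\<in>?F. single u (coeff f u)) * (\<Sum>w\<in>?G. single w (coeff g w)))"
    using group_alg_expansion[of f] group_alg_expansion[of g] by simp
  also have "\<dots> = (\<Sum>u\<in>?F. \<Sum>w\<in>?G. single (h u) (coeff f u) * single (h w) (coeff g w))"
    by (simp add: sum_product alg_map_sum single_mult_single assms)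
  also have "\<dots> = alg_map h f * (alg_map h g :: ('w, 'k) group_alg)"
    by (simp add: alg_map_eq sum_product)
  finally show ?thesis .
qed

lemma coeff_alg_map:
  "coeff (alg_map h f :: ('w::comm_monoid_add, 'k::comm_ring_1) group_alg) w =
    (\<Sum>u\<in>exponents f. if h u = w then coeff f u else 0)"
  by (simp add: alg_map_eq coeff_single eq_commute)

text \<open>Injectivity keeps distinct exponents apart, so each coefficient of \<open>f\<close>
  reappears in the image.\<close>

lemma alg_map_eq_0_iff:
  assumes "inj h"
  shows "alg_map h f = (0 :: ('w::comm_monoid_add, 'k::comm_ring_1) group_alg) \<longleftrightarrow>
    f = (0 :: ('v::comm_monoid_add, 'k) group_alg)"
proof
  assume 0: "alg_map h f = (0 :: ('w, 'k) group_alg)"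
  show "f = 0"
  proof (rule group_alg_eqI)
    fix u
    have "coeff (alg_map h f :: ('w, 'k) group_alg) (h u) = (\<Sum>w\<in>exponents f. if w = u then coeff f w else 0)"
      using assms by (simp add: coeff_alg_map inj_eq)
    also have "\<dots> = coeff f u" by (simp add: in_exponents_iff)
    finally show "coeff f u = coeff 0 u" using 0 by simp
  qed
qed simp

section \<open>Prime ideals and local rings\<close>

definition subring :: "'a::comm_ring_1 set \<Rightarrow> bool" where
  "subring A \<longleftrightarrow> 0 \<in> A \<and> 1 \<in> A \<and> (\<forall>a\<in>A. \<forall>b\<in>A. a - b \<in> A) \<and> (\<forall>a\<in>A. \<forall>b\<in>A. a * b \<in> A)"

lemma subringD:
  assumes "subring A"
  shows "0 \<in> A" "1 \<in> A" "\<And>a b. a \<in> A \<Longrightarrow> b \<in> A \<Longrightarrow> a - b \<in> A"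
    "\<And>a b. a \<in> A \<Longrightarrow> b \<in> A \<Longrightarrow> a * b \<in> A"
    and "\<And>a b. a \<in> A \<Longrightarrow> b \<in> A \<Longrightarrow> a + b \<in> A"
proof -
  show "0 \<in> A" "1 \<in> A" and diff: "\<And>a b. a \<in> A \<Longrightarrow> b \<in> A \<Longrightarrow> a - b \<in> A"
    and "\<And>a b. a \<in> A \<Longrightarrow> b \<in> A \<Longrightarrow> a * b \<in> A"
    using assms by (auto simp: subring_def)
  show "a \<in> A \<Longrightarrow> b \<in> A \<Longrightarrow> a + b \<in> A" for a b
    using diff[of a "0 - b"] diff[of 0 b] \<open>0 \<in> A\<close> by simp
qed

definition ideal_in :: "'a::comm_ring_1 set \<Rightarrow> 'a set \<Rightarrow> bool" where
  "ideal_in A I \<longleftrightarrow>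
     I \<subseteq> A \<and> 0 \<in> I \<and> (\<forall>a\<in>I. \<forall>b\<in>I. a + b \<in> I) \<and> (\<forall>a\<in>A. \<forall>b\<in>I. a * b \<in> I)"

lemma ideal_inD:
  assumes "ideal_in A I"
  shows "I \<subseteq> A" "0 \<in> I" "a \<in> I \<Longrightarrow> b \<in> I \<Longrightarrow> a + b \<in> I" "a \<in> A \<Longrightarrow> b \<in> I \<Longrightarrow> a * b \<in> I"
  using assms by (auto simp: ideal_in_def)

lemma prime_ideal_ideal_in: "prime_ideal A p \<Longrightarrow> ideal_in A p"
  by (simp add: prime_ideal_def ideal_in_def)

lemma ideal_in_add_principal:
  assumes "subring A" "ideal_in A I" "a \<in> A"
  shows "ideal_in A {x + r * a | x r. x \<in> I \<and> r \<in> A}"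
  unfolding ideal_in_def
proof (intro conjI ballI)
  show "{x + r * a | x r. x \<in> I \<and> r \<in> A} \<subseteq> A"
    using assms ideal_inD(1)[OF assms(2)] by (auto intro!: subringD[OF assms(1)])
  show "0 \<in> {x + r * a | x r. x \<in> I \<and> r \<in> A}"
    using ideal_inD(2)[OF assms(2)] subringD(1)[OF assms(1)] by force
next
  fix y z assume "y \<in> {x + r * a | x r. x \<in> I \<and> r \<in> A}" "z \<in> {x + r * a | x r. x \<in> I \<and> r \<in> A}"
  then obtain x r x' r' where "x \<in> I" "r \<in> A" "x' \<in> I" "r' \<in> A" "y + z = (x + x') + (r + r') * a"
    by (auto simp: algebra_simps)
  then show "y + z \<in> {x + r * a | x r. x \<in> I \<and> r \<in> A}"
    using ideal_inD(3)[OF assms(2)] subringD(5)[OF assms(1)] by blast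
next
  fix c y assume "c \<in> A" "y \<in> {x + r * a | x r. x \<in> I \<and> r \<in> A}"
  then obtain x r where "x \<in> I" "r \<in> A" "c * y = c * x + (c * r) * a"
    by (auto simp: algebra_simps)
  then show "c * y \<in> {x + r * a | x r. x \<in> I \<and> r \<in> A}"
    using \<open>c \<in> A\<close> ideal_inD(4)[OF assms(2)] subringD(4)[OF assms(1)] by blast
qed

text \<open>Krull's argument, relative to a subset \<open>A\<close> because the charts are subrings
  of one ambient domain: Zorn's lemma gives an ideal maximal among those that contain
  \<open>I\<close> and miss 1, and such an ideal is prime.\<close>

lemma exists_prime_ideal:
  fixes A :: "'a::idom set"
  assumes A: "subring A" and I: "ideal_in A I" "1 \<notin> I"
  obtains p where "prime_ideal A p" "I \<subseteq> p"
proof -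
  let ?\<A> = "{J. ideal_in A J \<and> I \<subseteq> J \<and> 1 \<notin> J}"
  have "\<exists>p\<in>?\<A>. \<forall>J\<in>?\<A>. p \<subseteq> J \<longrightarrow> J = p"
  proof (rule subset_Zorn_nonempty)
    show "?\<A> \<noteq> {}" using I by blast
    fix \<C> assume ne: "\<C> \<noteq> {}" and ch: "subset.chain ?\<A> \<C>"
    have mem: "ideal_in A J" "I \<subseteq> J" "1 \<notin> J" if "J \<in> \<C>" for J
      using ch that by (auto simp: subset_chain_def)
    have "ideal_in A (\<Union>\<C>)"
      unfolding ideal_in_def
    proof (intro conjI ballI)
      show "\<Union>\<C> \<subseteq> A" using mem(1) ideal_inD(1) by (intro Union_least) blast
      show "0 \<in> \<Union>\<C>" using ne mem(1) ideal_inD(2) by blast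
    next
      fix a b assume "a \<in> \<Union>\<C>" "b \<in> \<Union>\<C>"
      then obtain J K where JK: "J \<in> \<C>" "K \<in> \<C>" "a \<in> J" "b \<in> K" by blast
      then have "J \<subseteq> K \<or> K \<subseteq> J" using ch by (auto simp: subset_chain_def)
      then show "a + b \<in> \<Union>\<C>" using JK mem(1) ideal_inD(3) by blast
    next
      fix a b assume "a \<in> A" "b \<in> \<Union>\<C>"
      then show "a * b \<in> \<Union>\<C>" using mem(1) ideal_inD(4) by blast
    qed
    then show "\<Union>\<C> \<in> ?\<A>" using ne mem by blast
  qed
  then obtain p where p: "ideal_in A p" "I \<subseteq> p" "1 \<notin> p"
    and max: "\<And>J. ideal_in A J \<Longrightarrow> p \<subseteq> J \<Longrightarrow> 1 \<notin> J \<Longrightarrow> J = p"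
    by (smt (verit) mem_Collect_eq subset_trans)
  \<comment> \<open>By maximality, adjoining an element outside \<open>p\<close> produces the unit
    ideal.\<close>
  have unit: "\<exists>x\<in>p. \<exists>r\<in>A. 1 = x + r * a" if a: "a \<in> A" "a \<notin> p" for a
  proof (rule ccontr)
    let ?J = "{x + r * a | x r. x \<in> p \<and> r \<in> A}"
    assume "\<not> (\<exists>x\<in>p. \<exists>r\<in>A. 1 = x + r * a)"
    then have "1 \<notin> ?J" by auto
    moreover have "p \<subseteq> ?J" using subringD(1)[OF A] by force
    ultimately have "?J = p"
      using max ideal_in_add_principal[OF A p(1) a(1)] by blast
    moreover have "0 + 1 * a \<in> ?J" using ideal_inD(2)[OF p(1)] subringD(2)[OF A] by blast
    ultimately show False using a(2) by simp
  qed
  have "a \<in> p \<or> b \<in> p" if ab: "a \<in> A" "b \<in> A" "a * b \<in> p" for a b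
  proof (rule ccontr)
    assume "\<not> (a \<in> p \<or> b \<in> p)"
    with ab obtain x r y t where xr: "x \<in> p" "r \<in> A" "1 = x + r * a"
      and yt: "y \<in> p" "t \<in> A" "1 = y + t * b"
      using unit[of a] unit[of b] by blast
    have "y + t * b = 1" using yt(3) by simp
    \<comment> \<open>Multiply out \<open>1 = (x + r * a) * (y + t * b)\<close>: each summand has a
      factor \<open>x\<close>, \<open>y\<close> or \<open>a * b\<close> from
      \<open>p\<close>.\<close>
    then have "1 = (y + t * b) * x + r * a * (y + t * b)" using xr(3) by simp
    also have "\<dots> = (y + t * b) * x + ((r * a) * y + (r * t) * (a * b))"
      by (simp add: algebra_simps)
    also have "\<dots> \<in> p"
    proof (intro ideal_inD(3)[OF p(1)])
      show "(y + t * b) * x \<in> p"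
        using subringD(2)[OF A] xr by (subst \<open>y + t * b = 1\<close>) simp
      show "r * a * y \<in> p"
        using xr yt ab by (intro ideal_inD(4)[OF p(1)] subringD(4)[OF A])
      show "r * t * (a * b) \<in> p"
        using subringD(4)[OF A xr(2) yt(2)] ab(3) by (rule ideal_inD(4)[OF p(1)])
    qed
    finally show False using p(3) by contradiction
  qed
  then have "prime_ideal A p" using p by (auto simp: prime_ideal_def ideal_in_def)
  with p(2) show thesis using that by blast
qed

section \<open>Local rings inside the fraction field\<close>

lemma localizationE:
  assumes "z \<in> localization A p" "0 \<in> p"
  obtains a s where "a \<in> A" "s \<in> A" "s \<notin> p" "s \<noteq> 0" "z = Fract a s"
  using assms by (auto simp: localization_def)

lemma Fract_mult_denominator: "s \<noteq> 0 \<Longrightarrow> Fract s 1 * Fract a s = Fract a 1"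
  by (simp add: eq_fract)

text \<open>The denominators of \<open>z\<close> form an ideal of \<open>A\<close> that is contained in no prime ideal.\<close>

lemma Inter_localizations:
  fixes A :: "'a::idom set"
  assumes A: "subring A" and z: "\<And>p. prime_ideal A p \<Longrightarrow> z \<in> localization A p"
  obtains a where "a \<in> A" "z = Fract a 1"
proof -
  define J where "J = {s \<in> A. \<exists>a\<in>A. Fract s 1 * z = Fract a 1}"
  have "ideal_in A J"
    unfolding ideal_in_def
  proof (intro conjI ballI)
    show "J \<subseteq> A" by (auto simp: J_def)
    have "Fract 0 1 * z = Fract 0 1" by (simp add: fract_collapse)
    then show "0 \<in> J" using subringD(1)[OF A] by (auto simp: J_def)
  next
    fix s t assume "s \<in> J" "t \<in> J"
    then obtain a b where ab: "a \<in> A" "b \<in> A" "Fract s 1 * z = Fract a 1" "Fract t 1 * z = Fract b 1"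
      by (auto simp: J_def)
    have "Fract (s + t) 1 * z = (Fract s 1 + Fract t 1) * z" by simp
    also have "\<dots> = Fract (a + b) 1" unfolding distrib_right using ab by simp
    finally show "s + t \<in> J" using ab \<open>s \<in> J\<close> \<open>t \<in> J\<close> subringD(5)[OF A] by (auto simp: J_def)
  next
    fix c s assume "c \<in> A" "s \<in> J"
    then obtain a where a: "a \<in> A" "Fract s 1 * z = Fract a 1" by (auto simp: J_def)
    have "Fract (c * s) 1 * z = Fract c 1 * (Fract s 1 * z)" by (simp flip: mult.assoc)
    also have "\<dots> = Fract (c * a) 1" unfolding a(2) by simp
    finally show "c * s \<in> J" using a \<open>c \<in> A\<close> \<open>s \<in> J\<close> subringD(4)[OF A] by (auto simp: J_def)
  qed
  have "1 \<in> J"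
  proof (rule ccontr)
    assume "1 \<notin> J"
    with exists_prime_ideal[OF A \<open>ideal_in A J\<close>] obtain p where p: "prime_ideal A p" "J \<subseteq> p"
      by blast
    have "0 \<in> p" using p(1) by (simp add: prime_ideal_def)
    with z[OF p(1)] obtain a s where as: "a \<in> A" "s \<in> A" "s \<notin> p" "s \<noteq> 0" "z = Fract a s"
      by (rule localizationE)
    then have "s \<in> J" using Fract_mult_denominator by (auto simp: J_def)
    with p(2) as(3) show False by blast
  qed
  then show thesis using that by (auto simp: J_def fract_collapse)
qed

lemma localization_diff:
  assumes "subring A" "prime_ideal A p" "x \<in> localization A p" "y \<in> localization A p"
  shows "x - y \<in> localization A p"
proof -
  have p: "0 \<in> p" "\<And>s t. s \<in> A \<Longrightarrow> t \<in> A \<Longrightarrow> s \<notin> p \<Longrightarrow> t \<notin> p \<Longrightarrow> s * t \<notin> p"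
    using assms(2) by (auto simp: prime_ideal_def)
  obtain a s where a: "a \<in> A" "s \<in> A" "s \<notin> p" "s \<noteq> 0" "x = Fract a s"
    using assms(3) p(1) by (rule localizationE)
  obtain b t where b: "b \<in> A" "t \<in> A" "t \<notin> p" "t \<noteq> 0" "y = Fract b t"
    using assms(4) p(1) by (rule localizationE)
  have "x - y = Fract (a * t - b * s) (s * t)" using a b by simp
  then show ?thesis using a b p(2)[of s t]
    by (auto simp: localization_def intro!: exI conjI subringD[OF assms(1)])
qed

lemma prime_zero_ideal: "subring A \<Longrightarrow> prime_ideal (A :: 'a::idom set) {0}"
  by (auto simp: prime_ideal_def subringD)

text \<open>Cross-multiplication survives \<open>\<phi>\<close> and denominators stay nonzero, so
  all representatives of a fraction give the same value and the definite description is
  meaningful.\<close>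

lemma fract_map_Fract:
  assumes \<phi>: "\<And>a b. \<phi> (a * b) = \<phi> a * \<phi> b" "\<And>a. \<phi> a = 0 \<longleftrightarrow> a = 0" and "b \<noteq> 0"
  shows "fract_map \<phi> (Fract a b) = Fract (\<phi> a) (\<phi> b)"
  unfolding fract_map_def
proof (rule the_equality)
  show "\<exists>a' b'. b' \<noteq> 0 \<and> Fract a b = Fract a' b' \<and> Fract (\<phi> a) (\<phi> b) = Fract (\<phi> a') (\<phi> b')"
    using assms(3) by blast
next
  fix w assume "\<exists>a' b'. b' \<noteq> 0 \<and> Fract a b = Fract a' b' \<and> w = Fract (\<phi> a') (\<phi> b')"
  then obtain a' b' where b': "b' \<noteq> 0" "Fract a b = Fract a' b'" "w = Fract (\<phi> a') (\<phi> b')" by blast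
  then have "a * b' = a' * b" using assms(3) by (simp add: eq_fract)
  then have "\<phi> a * \<phi> b' = \<phi> a' * \<phi> b" by (metis \<phi>(1))
  then show "w = Fract (\<phi> a) (\<phi> b)" using b' assms(3) by (simp add: eq_fract \<phi>(2))
qed

section \<open>Affine charts of toric varieties\<close>

lemma localization_in_basic_open_1: "prime_ideal A p \<Longrightarrow> localization A p \<in> basic_open A 1"
  by (auto simp: basic_open_def prime_ideal_def)

lemma zariski_open_chart:
  assumes "A \<in> \<A>" "subring A"
  shows "zariski_open \<A> (basic_open A 1)" "basic_open A 1 \<noteq> {}"
proof -
  show "zariski_open \<A> (basic_open A 1)" unfolding zariski_open_def
    using assms(1) subringD(2)[OF assms(2)] by (intro exI[of _ "{basic_open A 1}"]) auto
  show "basic_open A 1 \<noteq> {}"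
    using localization_in_basic_open_1[OF prime_zero_ideal[OF assms(2)]] by blast
qed

text \<open>The inclusion from left to right is \<open>Inter_localizations\<close>. It turns
  sections over a chart into elements of the group algebra, whose exponents can be examined.\<close>

lemma sections_chart:
  assumes "subring A"
  shows "sections (basic_open A 1) = (\<lambda>a. Fract a 1) ` A"
proof
  show "sections (basic_open A 1) \<subseteq> (\<lambda>a. Fract a 1) ` A"
  proof
    fix z assume "z \<in> sections (basic_open A 1)"
    then have "z \<in> localization A p" if "prime_ideal A p" for p
      using localization_in_basic_open_1[OF that] by (auto simp: sections_def)
    then show "z \<in> (\<lambda>a. Fract a 1) ` A"
      using Inter_localizations[OF assms] by (metis image_eqI)
  qed
  show "(\<lambda>a. Fract a 1) ` A \<subseteq> sections (basic_open A 1)"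
    using subringD(2)[OF assms]
    by (auto simp: sections_def basic_open_def localization_def prime_ideal_def)
qed

text \<open>The monoid \<open>\<sigma>\<^sup>\<or> \<inter> M\<close>, so that
  \<open>cone_ring N \<sigma>\<close> is its monoid algebra.\<close>

definition dual_monoid :: "'v::euclidean_space set \<Rightarrow> 'v set \<Rightarrow> 'v set" where
  "dual_monoid N \<sigma> = {u \<in> dual_lattice N. \<forall>v\<in>\<sigma>. 0 \<le> u \<bullet> v}"

lemma cone_ring_iff: "f \<in> cone_ring N \<sigma> \<longleftrightarrow> exponents f \<subseteq> dual_monoid N \<sigma>"
  by (simp add: cone_ring_def dual_monoid_def)

lemma dual_monoid_0: "0 \<in> dual_monoid N \<sigma>"
  using add_subgroup_0[OF dual_lattice_add_subgroup] by (simp add: dual_monoid_def)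

lemma dual_monoid_add: "u \<in> dual_monoid N \<sigma> \<Longrightarrow> w \<in> dual_monoid N \<sigma> \<Longrightarrow> u + w \<in> dual_monoid N \<sigma>"
  by (auto simp: dual_monoid_def inner_add_left intro: add_subgroup_add[OF dual_lattice_add_subgroup])

lemma dual_monoid_scale: "u \<in> dual_monoid N \<sigma> \<Longrightarrow> of_nat n *\<^sub>R u \<in> dual_monoid N \<sigma>"
  by (auto simp: dual_monoid_def intro: add_subgroup_scale_nat[OF dual_lattice_add_subgroup])

lemma dual_monoid_zero_cone: "dual_monoid N {0} = dual_lattice N"
  by (auto simp: dual_monoid_def)

lemma dual_monoid_ray: "dual_monoid N (convex_cone hull {v}) = {u \<in> dual_lattice N. 0 \<le> u \<bullet> v}"
proof -
  have "v \<in> convex_cone hull {v}" by (simp add: hull_inc)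
  then have "(\<forall>x\<in>convex_cone hull {v}. 0 \<le> u \<bullet> x) \<longleftrightarrow> 0 \<le> u \<bullet> v" for u
    unfolding convex_cone_hull_singleton by auto
  then show ?thesis by (simp add: dual_monoid_def)
qed

lemma monom_in_cone_ring: "monom u \<in> cone_ring N \<sigma> \<longleftrightarrow> u \<in> dual_monoid N \<sigma>"
  by (simp add: cone_ring_iff)

lemma subring_cone_ring: "subring (cone_ring N \<sigma> :: ('v::euclidean_space, 'k::field) group_alg set)"
  unfolding subring_def
proof (intro conjI ballI)
  show "0 \<in> (cone_ring N \<sigma> :: ('v, 'k) group_alg set)" by (simp add: cone_ring_iff)
  show "1 \<in> (cone_ring N \<sigma> :: ('v, 'k) group_alg set)"
    by (simp add: monom_in_cone_ring dual_monoid_0 flip: monom_0)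
  fix f g :: "('v, 'k) group_alg" assume fg: "f \<in> cone_ring N \<sigma>" "g \<in> cone_ring N \<sigma>"
  have "exponents (f - g) \<subseteq> exponents f \<union> exponents g" by (auto simp: in_exponents_iff)
  then show "f - g \<in> cone_ring N \<sigma>" using fg by (auto simp: cone_ring_iff)
  show "f * g \<in> cone_ring N \<sigma>" unfolding cone_ring_iff
  proof
    fix c assume "c \<in> exponents (f * g)"
    then obtain a b where "a \<in> exponents f" "b \<in> exponents g" "c = a + b" by (rule exponents_mult)
    then show "c \<in> dual_monoid N \<sigma>" using fg by (auto simp: cone_ring_iff intro: dual_monoid_add)
  qed
qed

lemma zariski_open_toric_chart:
  assumes "\<sigma> \<in> \<Sigma>"
  shows "zariski_open (toric_charts N \<Sigma>)
      (basic_open (cone_ring N \<sigma> :: ('v::euclidean_space, 'k::field) group_alg set) 1)"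
    and "basic_open (cone_ring N \<sigma> :: ('v, 'k) group_alg set) 1 \<noteq> {}"
  using assms by (auto intro: zariski_open_chart(1)[OF _ subring_cone_ring] simp: toric_charts_def)
    (use zariski_open_chart(2)[OF _ subring_cone_ring] in blast)

lemma exponents_alg_map:
  "exponents (alg_map h f :: ('w::comm_monoid_add, 'k::comm_ring_1) group_alg) \<subseteq> h ` exponents f"
proof
  fix w assume "w \<in> exponents (alg_map h f :: ('w, 'k) group_alg)"
  then have "(\<Sum>u\<in>exponents f. if h u = w then coeff f u else 0) \<noteq> 0"
    unfolding in_exponents_iff coeff_alg_map .
  then obtain u where "u \<in> exponents f" "(if h u = w then coeff f u else 0) \<noteq> 0"
    by (rule sum.not_neutral_contains_not_neutral)
  then show "w \<in> h ` exponents f" by (auto split: if_splits)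
qed

lemma alg_map_in_cone_ring:
  assumes "f \<in> cone_ring N \<sigma>" "\<And>u. u \<in> dual_monoid N \<sigma> \<Longrightarrow> h u \<in> dual_monoid N' \<sigma>'"
  shows "alg_map h f \<in> cone_ring N' \<sigma>'"
  using assms exponents_alg_map[of h f] by (fastforce simp: cone_ring_iff)

lemma prime_ideal_comap:
  assumes "subring A" "prime_ideal A' p" "\<And>a. a \<in> A \<Longrightarrow> h a \<in> A'"
    and "h 0 = 0" "h 1 = 1" "\<And>a b. h (a + b) = h a + h b" "\<And>a b. h (a * b) = h a * h b"
  shows "prime_ideal A {a \<in> A. h a \<in> p}"
  using assms(2-) subringD[OF assms(1)] unfolding prime_ideal_def by auto

text \<open>Serves both for the endomorphism \<open>F\<close> and for the diagonal morphism: the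
  image of a point is given by the contraction of its prime ideal.\<close>

lemma prime_ideal_alg_map_comap:
  fixes p :: "('w::euclidean_space, 'k::field) group_alg set"
  assumes "prime_ideal (cone_ring N' \<sigma>') p"
    and "\<And>u. u \<in> dual_monoid N \<sigma> \<Longrightarrow> h u \<in> dual_monoid N' \<sigma>'"
    and "h 0 = 0" "\<And>u w. h (u + w) = h u + h w"
  shows "prime_ideal (cone_ring N \<sigma>)
    {f \<in> cone_ring N \<sigma> :: ('v::euclidean_space, 'k) group_alg set. alg_map h f \<in> p}"
  using assms
  by (intro prime_ideal_comap[OF subring_cone_ring assms(1)] alg_map_in_cone_ring alg_map_0
      alg_map_1 alg_map_add alg_map_mult)

lemma ideal_in_sum: "ideal_in A p \<Longrightarrow> (\<And>i. i \<in> I \<Longrightarrow> f i \<in> p) \<Longrightarrow> sum f I \<in> p"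
  by (induction I rule: infinite_finite_induct) (auto intro: ideal_inD)

text \<open>A monomial is a section near a point exactly if it is a quotient of monomials there. In this
  form the condition does not change when exponents are multiplied by \<open>q\<close>.\<close>

lemma monom_in_localization_iff:
  fixes p :: "('v::euclidean_space, 'k::field) group_alg set"
  assumes p: "prime_ideal (cone_ring N \<sigma>) p"
  shows "Fract (monom w) 1 \<in> localization (cone_ring N \<sigma>) p \<longleftrightarrow>
    (\<exists>u\<in>dual_monoid N \<sigma>. w + u \<in> dual_monoid N \<sigma> \<and> monom u \<notin> p)"
proof
  have ideal: "ideal_in (cone_ring N \<sigma>) p" using p by (rule prime_ideal_ideal_in)
  assume "Fract (monom w) 1 \<in> localization (cone_ring N \<sigma>) p"
  then obtain a s where as: "a \<in> cone_ring N \<sigma>" "s \<in> cone_ring N \<sigma>" "s \<notin> p" "s \<noteq> 0"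
    "Fract (monom w) 1 = Fract a s"
    using ideal_inD(2)[OF ideal] by (rule localizationE)
  then have "monom w * s = a" by (simp add: eq_fract)
  \<comment> \<open>If all monomials of \<open>s\<close> were in \<open>p\<close>, then so would be
    \<open>s\<close>, as a combination of them with coefficients in the field.\<close>
  have "\<exists>u\<in>exponents s. monom u \<notin> p"
  proof (rule ccontr)
    assume none: "\<not> (\<exists>u\<in>exponents s. monom u \<notin> p)"
    have "(\<Sum>u\<in>exponents s. single u (coeff s u)) \<in> p"
    proof (rule ideal_in_sum[OF ideal])
      fix u assume "u \<in> exponents s"
      then have "single 0 (coeff s u) * monom u \<in> p"
        using none dual_monoid_0
        by (intro ideal_inD(4)[OF ideal])
          (auto simp: cone_ring_iff in_exponents_iff coeff_single split: if_splits)
      then show "single u (coeff s u) \<in> p" by (simp add: single_mult_single)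
    qed
    with as(3) show False by (simp flip: group_alg_expansion)
  qed
  then obtain u where u: "u \<in> exponents s" "monom u \<notin> p" by blast
  have "w + u \<in> exponents a"
    unfolding \<open>monom w * s = a\<close>[symmetric] exponents_monom_mult using u by blast
  then show "\<exists>u\<in>dual_monoid N \<sigma>. w + u \<in> dual_monoid N \<sigma> \<and> monom u \<notin> p"
    using u as(1,2) by (auto simp: cone_ring_iff)
next
  assume "\<exists>u\<in>dual_monoid N \<sigma>. w + u \<in> dual_monoid N \<sigma> \<and> monom u \<notin> p"
  then obtain u where u: "u \<in> dual_monoid N \<sigma>" "w + u \<in> dual_monoid N \<sigma>" "monom u \<notin> p"
    by blast
  have "Fract (monom w) 1 = Fract (monom (w + u)) (monom u :: ('v, 'k) group_alg)"
    by (simp add: eq_fract monom_mult)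
  moreover have "monom (w + u) \<in> cone_ring N \<sigma>" "monom u \<in> cone_ring N \<sigma>"
    using u by (simp_all add: monom_in_cone_ring)
  ultimately show "Fract (monom w) 1 \<in> localization (cone_ring N \<sigma>) p"
    using u(3) unfolding localization_def by blast
qed

section \<open>The endomorphism \<open>F\<close>\<close>

context
  fixes q :: nat
  assumes q: "q > 0"
begin

lemma mult_alg_0_iff:
  "mult_alg q f = (0 :: ('v::euclidean_space, 'k::field) group_alg) \<longleftrightarrow> f = 0"
  using q by (intro alg_map_eq_0_iff) (auto simp: inj_def)

lemma fract_map_mult_alg_monom:
  "fract_map (mult_alg q) (Fract (monom u) 1) =
    Fract (monom (of_nat q *\<^sub>R u) :: ('v::euclidean_space, 'k::field) group_alg) 1"
proof -
  have "fract_map (mult_alg q) (Fract (monom u) 1) =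
      Fract (mult_alg q (monom u)) (mult_alg q 1 :: ('v, 'k) group_alg)"
    by (rule fract_map_Fract) (simp_all add: alg_map_mult mult_alg_0_iff scaleR_add_right)
  then show ?thesis by (simp add: alg_map_1)
qed

text \<open>At the image point under \<open>F\<close> the monomial is a quotient of
  \<open>monom (w + u)\<close> by a \<open>monom u\<close> that does not vanish there. The same
  quotient works at the point itself: if \<open>monom u\<close> vanished at it, then so would its
  \<open>q\<close>-th power, which is its pullback under \<open>F\<close>.\<close>

lemma monom_in_sections_mult_preimage:
  fixes N :: "'v::euclidean_space set"
  assumes w: "w \<in> dual_monoid N \<tau>"
  shows "Fract (monom w) 1 \<in> sections (mult_preimage N \<Sigma> q
    (basic_open (cone_ring N \<tau> :: ('v, 'k::field) group_alg set) 1))"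
  unfolding sections_def
proof (rule InterI)
  fix x assume "x \<in> mult_preimage N \<Sigma> q (basic_open (cone_ring N \<tau> :: ('v, 'k) group_alg set) 1)"
  then obtain \<sigma> p p' where x: "x = localization (cone_ring N \<sigma>) p"
    and p: "prime_ideal (cone_ring N \<sigma>) p" and p': "prime_ideal (cone_ring N \<tau>) p'"
    and eq: "localization (cone_ring N \<sigma>) {a \<in> cone_ring N \<sigma>. mult_alg q a \<in> p} =
      localization (cone_ring N \<tau> :: ('v, 'k) group_alg set) p'"
    unfolding preimage_def toric_charts_def basic_open_def by blast
  let ?P = "{a \<in> cone_ring N \<sigma>. mult_alg q a \<in> p}"
  have P: "prime_ideal (cone_ring N \<sigma>) ?P"
    by (intro prime_ideal_alg_map_comap[OF p] dual_monoid_scale) (simp_all add: scaleR_add_right)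
  have "Fract (monom w) 1 \<in> localization (cone_ring N \<tau>) p'"
    unfolding monom_in_localization_iff[OF p']
    using w p' by (intro bexI[of _ 0]) (auto simp: dual_monoid_0 monom_0 prime_ideal_def)
  then obtain u where u: "u \<in> dual_monoid N \<sigma>" "w + u \<in> dual_monoid N \<sigma>" "monom u \<notin> ?P"
    unfolding eq[symmetric] monom_in_localization_iff[OF P] by blast
  have "monom u \<notin> p"
  proof
    assume "monom u \<in> p"
    then have "monom (of_nat (q - 1) *\<^sub>R u) * monom u \<in> p"
      using u(1) by (intro ideal_inD(4)[OF prime_ideal_ideal_in[OF p]])
        (auto simp: monom_in_cone_ring dual_monoid_scale)
    moreover have "of_nat (q - 1) *\<^sub>R u + u = of_nat q *\<^sub>R u"
      using q by (simp add: of_nat_diff scaleR_diff_left)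
    ultimately have "mult_alg q (monom u) \<in> p" by (simp add: monom_mult)
    then show False using u(1,3) by (simp add: monom_in_cone_ring)
  qed
  then show "Fract (monom w) 1 \<in> x"
    unfolding x monom_in_localization_iff[OF p] using u by blast
qed

end

section \<open>Module maps\<close>

text \<open>The torus is the locus of the ray chart where \<open>monom s\<close> is invertible,
  since powers of \<open>monom s\<close> clear all negative orders along \<open>v\<close>. Hence a
  local ring of the torus is the local ring of the ray chart at the contracted prime ideal.\<close>

lemma basic_open_zero_cone_subset_ray:
  fixes N :: "'v::euclidean_space set"
  assumes s: "s \<in> dual_lattice N" "s \<bullet> v = 1"
  shows "basic_open (cone_ring N {0} :: ('v, 'k::field) group_alg set) 1
    \<subseteq> basic_open (cone_ring N (convex_cone hull {v})) 1"
proof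
  let ?A = "cone_ring N {0} :: ('v, 'k) group_alg set"
  let ?B = "cone_ring N (convex_cone hull {v}) :: ('v, 'k) group_alg set"
  have BA: "?B \<subseteq> ?A" by (auto simp: cone_ring_iff dual_monoid_zero_cone dual_monoid_ray)
  have shift: "\<exists>n. \<forall>m\<ge>n. monom (of_nat m *\<^sub>R s) * f \<in> ?B" if f: "f \<in> ?A" for f
  proof -
    \<comment> \<open>For \<open>f = 0\<close> this is the unspecified maximum of the empty set; any
      bound will do, as \<open>n\<close> is compared only with exponents of
      \<open>f\<close>.\<close>
    obtain n :: nat where n_def: "Max ((\<lambda>u. - (u \<bullet> v)) ` exponents f) \<le> n"
      by (rule exE[OF real_arch_simple])
    have n: "- (u \<bullet> v) \<le> n" if u: "u \<in> exponents f" for u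
    proof -
      have "- (u \<bullet> v) \<le> Max ((\<lambda>u. - (u \<bullet> v)) ` exponents f)"
        by (rule Max_ge[OF finite_imageI[OF finite_exponents] imageI[OF u]])
      then show ?thesis using n_def by (rule order_trans)
    qed
    have "monom (of_nat m *\<^sub>R s) * f \<in> ?B" if "m \<ge> n" for m
      unfolding cone_ring_iff exponents_monom_mult
    proof safe
      fix u assume u: "u \<in> exponents f"
      then have "u \<in> dual_lattice N" using f by (auto simp: cone_ring_iff dual_monoid_zero_cone)
      then show "of_nat m *\<^sub>R s + u \<in> dual_monoid N (convex_cone hull {v})"
        using n[OF u] that s
          add_subgroup_add[OF dual_lattice_add_subgroup
            add_subgroup_scale_nat[OF dual_lattice_add_subgroup s(1)]]
        by (simp add: dual_monoid_ray inner_add_left)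
    qed
    then show ?thesis by blast
  qed
  have monom_A: "monom (of_int m *\<^sub>R s) \<in> ?A" for m
    using add_subgroup_scale_int[OF dual_lattice_add_subgroup s(1)]
    by (simp add: monom_in_cone_ring dual_monoid_zero_cone)
  fix x assume "x \<in> basic_open ?A 1"
  then obtain p where x: "x = localization ?A p" and p: "prime_ideal ?A p"
    by (auto simp: basic_open_def)
  have "prime_ideal ?B {a \<in> ?B. a \<in> p}"
    by (rule prime_ideal_comap[OF subring_cone_ring p, where h = "\<lambda>a. a"]) (use BA in auto)
  moreover have "localization ?A p = localization ?B {a \<in> ?B. a \<in> p}"
  proof
    show "localization ?B {a \<in> ?B. a \<in> p} \<subseteq> localization ?A p"
      using BA by (auto simp: localization_def)
    show "localization ?A p \<subseteq> localization ?B {a \<in> ?B. a \<in> p}"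
    proof
      fix z assume "z \<in> localization ?A p"
      then obtain a t where at: "a \<in> ?A" "t \<in> ?A" "t \<notin> p" "t \<noteq> 0" "z = Fract a t"
        using p by (auto elim!: localizationE simp: prime_ideal_def)
      obtain n n' where n: "\<And>m. n \<le> m \<Longrightarrow> monom (of_nat m *\<^sub>R s) * a \<in> ?B"
        and n': "\<And>m. n' \<le> m \<Longrightarrow> monom (of_nat m *\<^sub>R s) * t \<in> ?B"
        using shift[OF at(1)] shift[OF at(2)] by blast
      \<comment> \<open>A common monomial factor moves numerator and denominator into
        \<open>?B\<close>; it is a unit of \<open>?A\<close>, so the denominator stays outside
        \<open>p\<close>.\<close>
      define e :: "('v, 'k) group_alg" where "e = monom (of_nat (max n n') *\<^sub>R s)"
      have "e * t \<notin> p"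
      proof
        assume "e * t \<in> p"
        then have "monom (of_int (- int (max n n')) *\<^sub>R s) * (e * t) \<in> p"
          by (rule ideal_inD(4)[OF prime_ideal_ideal_in[OF p] monom_A])
        moreover have "monom (of_int (- int (max n n')) *\<^sub>R s) * e = 1"
          by (simp add: e_def monom_mult monom_0 flip: scaleR_add_left)
        ultimately show False using at(3) by (simp flip: mult.assoc)
      qed
      moreover have "z = Fract (e * a) (e * t)"
        using at(5) by (simp add: mult_fract_cancel e_def)
      moreover have "e * a \<in> ?B" "e * t \<in> ?B" unfolding e_def using n n' by auto
      ultimately show "z \<in> localization ?B {a \<in> ?B. a \<in> p}" by (auto simp: localization_def)
    qed
  qed
  ultimately show "x \<in> basic_open ?B 1" unfolding x by (metis localization_in_basic_open_1)
qed

lemma module_mapD: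
  assumes "module_map N \<Sigma> q \<pi>" "zariski_open (toric_charts N \<Sigma>) U" "U \<noteq> {}"
  shows "t \<in> sections (mult_preimage N \<Sigma> q U) \<Longrightarrow> \<pi> U t \<in> sections U"
    and "t \<in> sections (mult_preimage N \<Sigma> q U) \<Longrightarrow> t' \<in> sections (mult_preimage N \<Sigma> q U) \<Longrightarrow>
      \<pi> U (t + t') = \<pi> U t + \<pi> U t'"
    and "s \<in> sections U \<Longrightarrow> t \<in> sections (mult_preimage N \<Sigma> q U) \<Longrightarrow>
      \<pi> U (fract_map (mult_alg q) s * t) = s * \<pi> U t"
    and "zariski_open (toric_charts N \<Sigma>) V \<Longrightarrow> V \<noteq> {} \<Longrightarrow> V \<subseteq> U \<Longrightarrow>
      t \<in> sections (mult_preimage N \<Sigma> q U) \<Longrightarrow> \<pi> V t = \<pi> U t"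
  using assms unfolding module_map_def by blast+

text \<open>After multiplication with a \<open>q\<close>-th power, \<open>x\<^sup>w\<close> has order between \<open>0\<close> and \<open>q - 1\<close> along the
  divisor of \<open>v\<close>, and its image is regular there.\<close>

lemma exponents_module_map_bound:
  fixes N :: "'v::euclidean_space set" and g :: "('v, 'k::field) group_alg"
  assumes \<pi>: "module_map N \<Sigma> q \<pi>" and q: "q > 0"
    and \<Sigma>: "{0} \<in> \<Sigma>" "convex_cone hull {v} \<in> \<Sigma>"
    and s: "s \<in> dual_lattice N" "s \<bullet> v = 1" and w: "w \<in> dual_lattice N"
    and g: "\<pi> (basic_open (cone_ring N {0}) 1) (Fract (monom w) 1) = Fract g 1"
    and b: "b \<in> exponents g"
  shows "w \<bullet> v / q - 1 < b \<bullet> v"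
proof -
  let ?A = "cone_ring N {0} :: ('v, 'k) group_alg set"
  let ?B = "cone_ring N (convex_cone hull {v}) :: ('v, 'k) group_alg set"
  let ?U = "basic_open ?A 1" and ?V = "basic_open ?B 1"
  have U: "zariski_open (toric_charts N \<Sigma>) ?U" "?U \<noteq> {}"
    using \<Sigma>(1) by (rule zariski_open_toric_chart)+
  have V: "zariski_open (toric_charts N \<Sigma>) ?V" "?V \<noteq> {}"
    using \<Sigma>(2) by (rule zariski_open_toric_chart)+
  \<comment> \<open>The least integer with \<open>q * j + w \<bullet> v \<ge> 0\<close>; the left
    side is then less than \<open>q\<close>.\<close>
  define j where "j = \<lceil>- (w \<bullet> v) / q\<rceil>"
  define js where "js = of_int j *\<^sub>R s"
  define w' where "w' = of_nat q *\<^sub>R js + w"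
  have js: "js \<in> dual_lattice N" "js \<bullet> v = of_int j"
    using s by (simp_all add: js_def add_subgroup_scale_int dual_lattice_add_subgroup)
  have "- (w \<bullet> v) / q \<le> of_int j" unfolding j_def by (rule le_of_int_ceiling)
  then have "0 \<le> w' \<bullet> v"
    using q js by (simp add: w'_def inner_add_left field_simps)
  moreover have "w' \<in> dual_lattice N" unfolding w'_def
    using w js by (intro add_subgroup_add add_subgroup_scale_nat dual_lattice_add_subgroup)
  ultimately have "w' \<in> dual_monoid N (convex_cone hull {v})" by (simp add: dual_monoid_ray)
  then have w'_section: "Fract (monom w') 1 \<in> sections (mult_preimage N \<Sigma> q ?V)"
    by (rule monom_in_sections_mult_preimage[OF q])
  then obtain g' where g': "g' \<in> ?B" "\<pi> ?V (Fract (monom w') 1) = Fract g' 1"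
    using module_mapD(1)[OF \<pi> V w'_section] by (auto simp: sections_chart subring_cone_ring)
  have "Fract (monom w') 1 =
      fract_map (mult_alg q) (Fract (monom js) 1) * Fract (monom w :: ('v, 'k) group_alg) 1"
    by (simp add: fract_map_mult_alg_monom[OF q] monom_mult w'_def)
  moreover have "Fract (monom js) 1 \<in> sections ?U"
    using js by (simp add: sections_chart subring_cone_ring monom_in_cone_ring dual_monoid_zero_cone)
  moreover have "Fract (monom w) 1 \<in> sections (mult_preimage N \<Sigma> q ?U)"
    using w by (intro monom_in_sections_mult_preimage[OF q]) (simp add: dual_monoid_zero_cone)
  \<comment> \<open>Linearity takes the \<open>q\<close>-th power of \<open>monom js\<close>, which
    is its pullback, out of \<open>\<pi>\<close> as \<open>monom js\<close>.\<close>
  ultimately have "\<pi> ?U (Fract (monom w') 1) = Fract (monom js * g) 1"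
    using module_mapD(3)[OF \<pi> U] g by simp
  \<comment> \<open>Restriction from the ray chart to the torus shows that this value is
    \<open>g'\<close>, which is regular along the divisor of \<open>v\<close>.\<close>
  moreover have "\<pi> ?U (Fract (monom w') 1) = \<pi> ?V (Fract (monom w') 1)"
    by (rule module_mapD(4)[OF \<pi> V U basic_open_zero_cone_subset_ray[OF s] w'_section])
  ultimately have "g' = monom js * g" using g' by (simp add: eq_fract)
  then have "js + b \<in> exponents g'" using b by (simp add: exponents_monom_mult)
  then have "0 \<le> (js + b) \<bullet> v" using g'(1) by (auto simp: cone_ring_iff dual_monoid_ray)
  \<comment> \<open>The ceiling exceeds its argument by strictly less than 1, whence the strict
    inequality in the conclusion.\<close>
  moreover have "of_int j < - (w \<bullet> v) / q + 1" unfolding j_def by linarith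
  ultimately show ?thesis using js by (simp add: inner_add_left)
qed

section \<open>The diagonal\<close>

text \<open>Elements of a dual lattice are confined to the span, so the span of the product has to
  be split as well. Pairing with \<open>(v, 0)\<close> and \<open>(0, v)\<close>, which lie in the
  product because 0 is in \<open>N\<close>, separates the components.\<close>

lemma dual_lattice_Times:
  fixes N :: "'v::euclidean_space set"
  assumes "add_subgroup N"
  shows "dual_lattice (N \<times> N) = dual_lattice N \<times> dual_lattice N"
proof -
  have 0: "0 \<in> N" using assms by (rule add_subgroup_0)
  have fst: "fst u \<in> span N" and snd: "snd u \<in> span N" if "u \<in> span (N \<times> N)" for u
  proof -
    have "fst u \<in> span (fst ` (N \<times> N))" "snd u \<in> span (snd ` (N \<times> N))"
      unfolding linear_span_image[OF linear_fst] linear_span_image[OF linear_snd]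
      using that by blast+
    moreover have "fst ` (N \<times> N) \<subseteq> N" "snd ` (N \<times> N) \<subseteq> N" by auto
    ultimately show "fst u \<in> span N" "snd u \<in> span N" using span_mono by blast+
  qed
  have pair: "(u, w) \<in> span (N \<times> N)" if "u \<in> span N" "w \<in> span N" for u w
  proof -
    have lin: "linear (\<lambda>u :: 'v. (u, 0 :: 'v))" "linear (\<lambda>w :: 'v. (0 :: 'v, w))"
      by (auto intro!: linearI)
    have "(u, 0) \<in> span ((\<lambda>u. (u, 0 :: 'v)) ` N)" "(0, w) \<in> span ((\<lambda>w. (0 :: 'v, w)) ` N)"
      unfolding linear_span_image[OF lin(1)] linear_span_image[OF lin(2)] using that by blast+
    moreover have "(\<lambda>u. (u, 0)) ` N \<subseteq> N \<times> N" "(\<lambda>w. (0, w)) ` N \<subseteq> N \<times> N" using 0 by auto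
    ultimately have "(u, 0) \<in> span (N \<times> N)" "(0, w) \<in> span (N \<times> N)" using span_mono by blast+
    from span_add[OF this] show ?thesis by simp
  qed
  show ?thesis
  proof (intro set_eqI iffI)
    fix u assume "u \<in> dual_lattice (N \<times> N)"
    then have "u \<in> span (N \<times> N)" "\<And>v v'. v \<in> N \<Longrightarrow> v' \<in> N \<Longrightarrow> u \<bullet> (v, v') \<in> \<int>"
      by (auto simp: dual_lattice_def)
    from this(1) this(2)[OF _ 0] this(2)[OF 0] show "u \<in> dual_lattice N \<times> dual_lattice N"
      using fst snd by (cases u) (auto simp: dual_lattice_def)
  next
    fix u assume "u \<in> dual_lattice N \<times> dual_lattice N"
    then show "u \<in> dual_lattice (N \<times> N)" using pair by (auto simp: dual_lattice_def)
  qed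
qed

text \<open>Clearing denominators would give \<open>u * s \<in> p\<close> with both factors outside
  \<open>p\<close>. The purpose is to show that \<open>n / u\<close>, which vanishes at the point,
  has no regular inverse there.\<close>

lemma Fract_notin_localization:
  assumes "prime_ideal A p" "n \<in> p" "n \<noteq> 0" "u \<in> A" "u \<notin> p"
  shows "Fract u n \<notin> localization A p"
proof
  assume "Fract u n \<in> localization A p"
  then obtain a s where as: "a \<in> A" "s \<in> A" "s \<notin> p" "s \<noteq> 0" "Fract u n = Fract a s"
    using assms(1) by (auto elim!: localizationE simp: prime_ideal_def)
  then have "u * s = a * n" using assms(3) by (simp add: eq_fract)
  also have "\<dots> \<in> p" using as assms by (simp add: prime_ideal_def)
  finally show False using as assms by (auto simp: prime_ideal_def)
qed

text \<open>Elements of \<open>A\<close> outside \<open>p\<close> are units of the local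
  ring.\<close>

lemma in_prime_ideal_if_in_maximal_ideal:
  assumes "subring A" "prime_ideal A p" "h \<in> A" "Fract h 1 \<in> maximal_ideal (localization A p)"
  shows "h \<in> p"
proof (rule ccontr)
  assume "h \<notin> p"
  moreover have "0 \<in> p" using assms(2) by (simp add: prime_ideal_def)
  ultimately have "Fract h 1 \<noteq> 0" by (auto simp: Zero_fract_def eq_fract)
  moreover have "inverse (Fract h 1) \<in> localization A p"
    using \<open>h \<notin> p\<close> assms(3) subringD(2)[OF assms(1)] by (auto simp: localization_def)
  ultimately show False using assms(4) by (simp add: maximal_ideal_def)
qed

text \<open>Pullback of functions along the diagonal morphism.\<close>

abbreviation add_alg :: "('v::euclidean_space \<times> 'v, 'k::field) group_alg \<Rightarrow> ('v, 'k) group_alg" where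
  "add_alg \<equiv> alg_map (\<lambda>(u, w). u + w)"

text \<open>Nonnegativity of \<open>(u1, u2)\<close> on the vectors \<open>(x, x)\<close> makes
  \<open>u1 + u2\<close> nonnegative on \<open>\<sigma>\<close>, so pullback to the diagonal
  respects the charts.\<close>

lemma prime_ideal_add_alg_comap:
  fixes p :: "('v::euclidean_space, 'k::field) group_alg set"
  assumes "add_subgroup N" "prime_ideal (cone_ring N \<sigma>) p"
  shows "prime_ideal (cone_ring (N \<times> N) (\<sigma> \<times> \<sigma>)) {f \<in> cone_ring (N \<times> N) (\<sigma> \<times> \<sigma>). add_alg f \<in> p}"
proof (rule prime_ideal_alg_map_comap[OF assms(2)])
  fix u assume "u \<in> dual_monoid (N \<times> N) (\<sigma> \<times> \<sigma>)"
  then obtain u1 u2 where "u = (u1, u2)" "u1 \<in> dual_lattice N" "u2 \<in> dual_lattice N"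
    "\<And>x. x \<in> \<sigma> \<Longrightarrow> 0 \<le> (u1, u2) \<bullet> (x, x)"
    by (cases u) (auto simp: dual_monoid_def dual_lattice_Times[OF assms(1)])
  then show "(case u of (u, w) \<Rightarrow> u + w) \<in> dual_monoid N \<sigma>"
    by (auto simp: dual_monoid_def inner_add_left intro: add_subgroup_add[OF dual_lattice_add_subgroup])
qed (auto simp: zero_prod_def)

text \<open>At a diagonal point of the preimage, \<open>monom (m, - m)\<close> is a quotient of two
  chart monomials with the same image under \<open>add_alg\<close>, so subtracting 1 leaves a
  numerator that vanishes there.\<close>

lemma antidiagonal_monom_in_ideal_sections:
  fixes N :: "'v::euclidean_space set"
  defines "U \<equiv> basic_open (cone_ring (N \<times> N) {0} :: ('v \<times> 'v, 'k::field) group_alg set) 1"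
  assumes N: "add_subgroup N" and q: "q > 0" and m: "m \<in> dual_lattice N"
  shows "Fract (monom (m, - m)) 1 - 1 \<in> ideal_sections (diagonal N \<Sigma>) (mult_preimage (N \<times> N) \<Sigma>' q U)"
proof -
  let ?t = "Fract (monom (m, - m)) 1 :: ('v \<times> 'v, 'k) group_alg fract"
  let ?W = "mult_preimage (N \<times> N) \<Sigma>' q U"
  have "(m, - m) \<in> dual_monoid (N \<times> N) {0}"
    using m add_subgroup_uminus[OF dual_lattice_add_subgroup m]
    by (simp add: dual_monoid_zero_cone dual_lattice_Times[OF N])
  then have t: "?t \<in> sections ?W"
    unfolding U_def by (rule monom_in_sections_mult_preimage[OF q])
  have "Fract (monom 0) 1 \<in> sections ?W"
    unfolding U_def using dual_monoid_0 by (rule monom_in_sections_mult_preimage[OF q])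
  then have one: "1 \<in> sections ?W" by (simp add: monom_0 fract_collapse)
  have section_diff: "?t - 1 \<in> x" if x: "x \<in> ?W" for x
  proof -
    obtain \<sigma> p where "x = localization (cone_ring (N \<times> N) \<sigma>) p" "prime_ideal (cone_ring (N \<times> N) \<sigma>) p"
      using x unfolding preimage_def toric_charts_def by blast
    moreover have "?t \<in> x" "1 \<in> x" using t one x by (auto simp: sections_def)
    ultimately show ?thesis using localization_diff[OF subring_cone_ring] by blast
  qed
  moreover have "?t - 1 \<in> maximal_ideal x" if x: "x \<in> diagonal N \<Sigma>" "x \<in> ?W" for x
  proof -
    obtain \<sigma> p where p: "prime_ideal (cone_ring N \<sigma>) p"
      and x_eq: "x = localization (cone_ring (N \<times> N) (\<sigma> \<times> \<sigma>))
        {f \<in> cone_ring (N \<times> N) (\<sigma> \<times> \<sigma>). add_alg f \<in> p}"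
      using x(1) by (auto simp: diagonal_def)
    let ?A = "cone_ring (N \<times> N) (\<sigma> \<times> \<sigma>) :: ('v \<times> 'v, 'k) group_alg set"
    let ?P = "{f \<in> ?A. add_alg f \<in> p}"
    have P: "prime_ideal ?A ?P" using N p by (rule prime_ideal_add_alg_comap)
    have "?t \<in> localization ?A ?P" using t x(2) by (auto simp: sections_def simp flip: x_eq)
    then obtain u where u: "u \<in> dual_monoid (N \<times> N) (\<sigma> \<times> \<sigma>)"
      "(m, - m) + u \<in> dual_monoid (N \<times> N) (\<sigma> \<times> \<sigma>)" "monom u \<notin> ?P"
      unfolding monom_in_localization_iff[OF P] by blast
    define n :: "('v \<times> 'v, 'k) group_alg" where "n = monom ((m, - m) + u) - monom u"
    have "n \<in> ?A" unfolding n_def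
      using u by (intro subringD(3)[OF subring_cone_ring]) (simp_all add: monom_in_cone_ring)
    moreover have "add_alg n = 0" by (cases u) (simp add: n_def alg_map_diff)
    ultimately have "n \<in> ?P" using p by (simp add: prime_ideal_def)
    have "?t - 1 = Fract (monom (m, - m)) 1 - Fract 1 1" by (simp add: fract_collapse)
    also have "\<dots> = Fract n (monom u)"
      by (simp add: n_def eq_fract algebra_simps monom_mult)
    finally have t1: "?t - 1 = Fract n (monom u)" .
    \<comment> \<open>The case \<open>n = 0\<close> has to be separated, as
      \<open>inverse 0 = 0\<close> lies in the local ring.\<close>
    have "?t - 1 = 0 \<or> inverse (?t - 1) \<notin> x"
    proof (cases "n = 0")
      case True
      then show ?thesis by (simp add: t1 fract_collapse)
    next
      case False
      then show ?thesis
        using Fract_notin_localization[OF P \<open>n \<in> ?P\<close>, of "monom u"] u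
        by (simp add: t1 x_eq monom_in_cone_ring)
    qed
    with section_diff[OF x(2)] show ?thesis by (simp add: maximal_ideal_def)
  qed
  ultimately show ?thesis by (auto simp: ideal_sections_def sections_def)
qed

text \<open>The zero ideal of the torus chart gives the generic point of the diagonal, whose prime
  ideal in \<open>A\<close> consists of the elements killed by \<open>add_alg\<close>.\<close>

lemma generic_diagonal_point:
  fixes N :: "'v::euclidean_space set"
  defines "A \<equiv> cone_ring (N \<times> N) {0} :: ('v \<times> 'v, 'k::field) group_alg set"
  assumes N: "add_subgroup N" and \<Sigma>: "{0} \<in> \<Sigma>"
    and h: "h \<in> A" "Fract h 1 \<in> ideal_sections (diagonal N \<Sigma>) (basic_open A 1)"
  shows "add_alg h = 0"
proof -
  have zero: "{0} = {0 :: 'v} \<times> {0 :: 'v}" by (auto simp: zero_prod_def)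
  have prime: "prime_ideal (cone_ring N {0}) {0 :: ('v, 'k) group_alg}"
    by (rule prime_zero_ideal[OF subring_cone_ring])
  let ?P = "{f \<in> A. add_alg f \<in> {0}}"
  have P: "prime_ideal A ?P"
    unfolding A_def zero using N prime by (rule prime_ideal_add_alg_comap)
  have "localization A ?P \<in> diagonal N \<Sigma>"
    unfolding diagonal_def A_def zero using \<Sigma> prime by blast
  moreover have "localization A ?P \<in> basic_open A 1" using P by (rule localization_in_basic_open_1)
  ultimately have "Fract h 1 \<in> maximal_ideal (localization A ?P)"
    using h(2) by (auto simp: ideal_sections_def)
  then have "h \<in> ?P"
    using in_prime_ideal_if_in_maximal_ideal[OF _ P h(1)] by (simp add: A_def subring_cone_ring)
  then show ?thesis by simp
qed

text \<open>These rays correspond to the boundary divisors of \<open>v\<close> in the two factors of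
  the product.\<close>

lemma ray_Times_zero:
  "convex_cone hull {(v, 0)} = (convex_cone hull {v}) \<times> {0}"
  "convex_cone hull {(0, v)} = {0} \<times> (convex_cone hull {v})"
  by (auto simp: convex_cone_hull_singleton)

lemma representatives_if_diagonally_split:
  fixes N :: "'v::euclidean_space set"
  assumes N: "is_lattice N" and \<Sigma>: "complete_fan N \<Sigma>" and q: "q > 0"
    and split: "diagonally_split TYPE('k::field) N \<Sigma> q" and m: "m \<in> dual_lattice N"
  shows "\<exists>m'\<in>dual_lattice N. \<forall>v\<in>ray_generators N \<Sigma>. \<bar>((1 / q) *\<^sub>R m - m') \<bullet> v\<bar> < 1"
proof -
  obtain \<pi> :: "('v \<times> 'v, 'k) group_alg fract set set
      \<Rightarrow> ('v \<times> 'v, 'k) group_alg fract \<Rightarrow> ('v \<times> 'v, 'k) group_alg fract"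
    where splitting: "splitting (N \<times> N) (product_fan \<Sigma> \<Sigma>) q \<pi>"
      and compatible: "compatible (N \<times> N) (product_fan \<Sigma> \<Sigma>) q \<pi> (diagonal N \<Sigma>)"
    using split unfolding diagonally_split_def by blast
  have \<pi>: "module_map (N \<times> N) (product_fan \<Sigma> \<Sigma>) q \<pi>"
    using splitting by (simp add: splitting_def)
  have sub: "add_subgroup N" using N by (rule lattice_add_subgroup)
  have zero: "{0} \<in> \<Sigma>" using \<Sigma> by (rule zero_cone_in_complete_fan)
  have zero_eq: "{0} = {0 :: 'v} \<times> {0 :: 'v}" by (auto simp: zero_prod_def)
  have zero2: "{0} \<in> product_fan \<Sigma> \<Sigma>" unfolding product_fan_def zero_eq using zero by blast
  let ?A = "cone_ring (N \<times> N) {0} :: ('v \<times> 'v, 'k) group_alg set"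
  let ?U = "basic_open ?A 1"
  let ?W = "mult_preimage (N \<times> N) (product_fan \<Sigma> \<Sigma>) q ?U"
  let ?t = "Fract (monom (m, - m)) 1 :: ('v \<times> 'v, 'k) group_alg fract"
  have U: "zariski_open (toric_charts (N \<times> N) (product_fan \<Sigma> \<Sigma>)) ?U" "?U \<noteq> {}"
    using zero2 by (rule zariski_open_toric_chart)+
  have w: "(m, - m) \<in> dual_lattice (N \<times> N)"
    using m add_subgroup_uminus[OF dual_lattice_add_subgroup m] by (simp add: dual_lattice_Times[OF sub])
  have "?t \<in> sections ?W"
    using w by (intro monom_in_sections_mult_preimage[OF q]) (simp add: dual_monoid_zero_cone)
  then obtain g where g: "g \<in> ?A" "\<pi> ?U ?t = Fract g 1"
    using module_mapD(1)[OF \<pi> U] by (auto simp: sections_chart subring_cone_ring)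
  have "Fract (monom 0 :: ('v \<times> 'v, 'k) group_alg) 1 \<in> sections ?W"
    using dual_monoid_0 by (rule monom_in_sections_mult_preimage[OF q])
  then have one_W: "1 \<in> sections ?W" by (simp add: monom_0 fract_collapse)
  have "1 \<in> ?A" by (rule subringD(2)[OF subring_cone_ring])
  then have one_U: "1 \<in> sections ?U" unfolding sections_chart[OF subring_cone_ring]
    by (metis One_fract_def imageI)
  \<comment> \<open>As 1 is its own pullback, the splitting property makes \<open>\<pi>\<close> fix
    it.\<close>
  have "fract_map (mult_alg q) (1 :: ('v \<times> 'v, 'k) group_alg fract) = 1"
    using fract_map_mult_alg_monom[OF q, of 0] by (simp add: monom_0 fract_collapse)
  then have \<pi>1: "\<pi> ?U 1 = 1" using splitting U one_U unfolding splitting_def by metis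
  have ideal: "?t - 1 \<in> ideal_sections (diagonal N \<Sigma>) ?W"
    using sub q m by (rule antidiagonal_monom_in_ideal_sections)
  \<comment> \<open>\<open>module_map\<close> provides additivity for sums, so \<open>?t\<close> is
    written as \<open>(?t - 1) + 1\<close>.\<close>
  then have "\<pi> ?U ((?t - 1) + 1) = \<pi> ?U (?t - 1) + \<pi> ?U 1"
    using one_W by (intro module_mapD(2)[OF \<pi> U]) (auto simp: ideal_sections_def)
  then have "\<pi> ?U (?t - 1) = Fract g 1 - Fract 1 1" using g \<pi>1 by (simp add: fract_collapse)
  also have "\<dots> = Fract (g - 1) 1" by simp
  finally have "Fract (g - 1) 1 \<in> ideal_sections (diagonal N \<Sigma>) ?U"
    using compatible U ideal unfolding compatible_def by metis
  then have "add_alg (g - 1) = 0"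
    using sub zero g \<open>1 \<in> ?A\<close>
    by (intro generic_diagonal_point) (auto intro: subringD(3)[OF subring_cone_ring])
  moreover have "add_alg (1 :: ('v \<times> 'v, 'k) group_alg) = 1"
    by (rule alg_map_1) (simp add: zero_prod_def)
  ultimately have "add_alg g = 1" by (simp add: alg_map_diff)
  \<comment> \<open>The constant term on the diagonal collects the coefficients of \<open>g\<close>
    at exponents with \<open>b1 + b2 = 0\<close>; since it is 1, such an exponent occurs.\<close>
  then have "coeff (add_alg g) 0 = (1 :: 'k)" by (simp add: coeff_single flip: monom_0)
  then have "0 \<in> exponents (add_alg g)" by (simp add: in_exponents_iff)
  then obtain b1 b2 where b: "(b1, b2) \<in> exponents g" "b1 + b2 = 0"
    using exponents_alg_map[of "\<lambda>(u, w). u + w" g] by force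
  have b2: "b2 = - b1" using b(2) by (simp add: eq_neg_iff_add_eq_0 add.commute)
  have "(b1, b2) \<in> dual_lattice (N \<times> N)"
    using b(1) g(1) by (auto simp: cone_ring_iff dual_monoid_zero_cone)
  then have b1: "b1 \<in> dual_lattice N" by (simp add: dual_lattice_Times[OF sub])
  have "\<bar>((1 / q) *\<^sub>R m - b1) \<bullet> v\<bar> < 1" if v: "v \<in> ray_generators N \<Sigma>" for v
  proof -
    have prim: "primitive N v" and ray: "convex_cone hull {v} \<in> \<Sigma>"
      using v by (auto simp: ray_generators_def)
    obtain s where s: "s \<in> dual_lattice N" "s \<bullet> v = 1" using primitive_dual_eq_1[OF N prim] .
    have s2: "(s, 0) \<in> dual_lattice (N \<times> N)" "(0, s) \<in> dual_lattice (N \<times> N)"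
      using s(1) add_subgroup_0[OF dual_lattice_add_subgroup] by (auto simp: dual_lattice_Times[OF sub])
    have rays: "convex_cone hull {(v, 0)} \<in> product_fan \<Sigma> \<Sigma>"
      "convex_cone hull {(0, v)} \<in> product_fan \<Sigma> \<Sigma>"
      unfolding product_fan_def ray_Times_zero using ray zero by blast+
    \<comment> \<open>The first factor bounds \<open>b1 \<bullet> v\<close> from below; the second,
      with the signs of \<open>m\<close> and \<open>b1\<close> reversed, bounds it from
      above.\<close>
    have "(m, - m) \<bullet> (v, 0) / q - 1 < (b1, b2) \<bullet> (v, 0)"
      using s(2) by (intro exponents_module_map_bound[OF \<pi> q zero2 rays(1) s2(1) _ w g(2) b(1)]) simp
    moreover have "(m, - m) \<bullet> (0, v) / q - 1 < (b1, b2) \<bullet> (0, v)"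
      using s(2) by (intro exponents_module_map_bound[OF \<pi> q zero2 rays(2) s2(2) _ w g(2) b(1)]) simp
    ultimately show ?thesis by (simp add: b2 inner_diff_left abs_less_iff)
  qed
  then show ?thesis using b1 by blast
qed

theorem theorem1p5:
  fixes N :: "'v::euclidean_space set" and \<Sigma> :: "'v set set"
  assumes "is_lattice N"
    and "complete_fan N \<Sigma>"
    and "\<not> k_regular 2 N (ray_generators N \<Sigma>)"
  shows "\<not> (\<exists>q\<ge>2. diagonally_split TYPE('k::field) N \<Sigma> q)"
proof
  assume "\<exists>q\<ge>2. diagonally_split TYPE('k) N \<Sigma> q"
  then obtain q where q: "2 \<le> q" and split: "diagonally_split TYPE('k) N \<Sigma> q" by blast
  have "k_regular 2 N (ray_generators N \<Sigma>)"
  proof (rule two_regular_if_representatives[OF assms(1) _ span_ray_generators[OF assms(1,2)] q])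
    show "ray_generators N \<Sigma> \<subseteq> N" by (auto simp: ray_generators_def primitive_def)
    show "\<exists>m'\<in>dual_lattice N. \<forall>v\<in>ray_generators N \<Sigma>. \<bar>((1 / q) *\<^sub>R m - m') \<bullet> v\<bar> < 1"
      if "m \<in> dual_lattice N" for m
      using representatives_if_diagonally_split[OF assms(1,2) _ split that] q by simp
  qed
  with assms(3) show False by contradiction
qed

end
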